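(* Let $\mathbb{K}$ be a field of characteristic zero. Below, all parameters $r,s,r_1,s_1,r_2,s_2$ are elements of $\mathbb{K}^{*}$ that are not roots of unity, $\phi_1,\phi_2\in\mathbb{K}[t]$, all exponents $i,j,i_1,j_1,i_2,j_2$ are integers, and $\cong$ means isomorphic as $\mathbb{K}$-algebras. (1) If $r_{1}^{i}s_{1}^{j}=1$ implies $i=j=0$ and $r_{2}^{i}s_{2}^{j}=1$ does not imply $i=j=0$, then $\mathcal{A}(r_{1},s_{1},\phi_{1})$ is never isomorphic to $\mathcal{A}(r_{2},s_{2},\phi_{2})$. (2) If $r^{i}s^{j}=1$ implies $i=j=0$, then $\mathcal{A}(r,s,\phi_{1})\cong\mathcal{A}(r,s,\phi_{2})$ if and only if $\phi_{1}(at+b)=\eta\phi_{2}(t)$ for some $\eta,a\in\mathbb{K}^{*}$ and $b\in\mathbb{K}$. (3) If $r_{1}^{i_{1}}s_{1}^{j_{1}}=r_{2}^{i_{2}}s_{2}^{j_{2}}=1$ implies $i_{1}=j_{1}=i_{2}=j_{2}=0$, then $\mathcal{A}(r_{1},s_{1},\phi_{1})$ is isomorphic to $\mathcal{A}(r_{2},s_{2},\phi_{2})$ if and only if (a) either $r_{1}=r_{2}$, $s_{1}=s_{2}$ and $\phi_{1}(at+b)=\eta\phi_{2}(t)$ for some $\eta,a\in\mathbb{K}^{*}$ and $b\in\mathbb{K}$; (b) or $r_{1}=s_{2}$, $r_{2}=s_{1}$ and $\phi_{1}(at+b)=\eta\phi_{2}(t)$ for some $\eta,a\in\mathbb{K}^{*}$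 and $b\in\mathbb{K}$; (c) or $r_{1}=s_{2}^{-1}$, $r_{2}=s_{1}^{-1}$ and $\phi_{1}(at+b)=\eta\phi_{2}(t)$ for some $\eta,a\in\mathbb{K}^{*}$ and $b\in\mathbb{K}$; (d) or $r_{1}=r_{2}^{-1}$, $s_{1}=s_{2}^{-1}$ and $\phi_{1}(at+b)=\eta\phi_{2}(t)$ for some $\eta,a\in\mathbb{K}^{*}$ and $b\in\mathbb{K}$. (4) $\mathcal{A}(r,r^{-1},\phi_{1})\cong\mathcal{A}(r,r^{-1},\phi_{2})$ if and only if $\phi_{1}(at+b)=\eta\phi_{2}(t)$ for some $\eta,a\in\mathbb{K}^{*}$ and $b\in\mathbb{K}$.
   Context: For $r,s\in\mathbb{K}^*$ and $\phi\in\mathbb{K}[t]$, $\mathcal{A}(r,s,\phi)$ denotes the (unital associative) $\mathbb{K}$-algebra generated by $u,d,t$ subject to the relations $tu=ut$, $td=dt$, $d^{2}u-(r+s)dud+rs\,ud^{2}-\phi(t)d=0$ and $du^{2}-(r+s)udu+rs\,u^{2}d-\phi(t)u=0$. *)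

theory Defs
  imports
    "HOL-Library.Poly_Mapping"
    "HOL-Computational_Algebra.Polynomial"
    "HOL-Algebra.QuotRing"
    "HOL-Algebra.Module"
begin

section \<open>Free algebras\<close>

text \<open>
  The free monoid on a type of generators is written additively only because the convolution
  product on \<^typ>\<open>'a \<Rightarrow>\<^sub>0 'b\<close> expects an additive (not necessarily commutative) monoid of
  exponents. The free unital algebra is then the monoid algebra of the free monoid.
\<close>

datatype 'g free_monoid = Letters (letters: "'g list")

instantiation free_monoid :: (type) monoid_add
begin

definition zero_free_monoid :: "'a free_monoid" where
  "0 = Letters []"

definition plus_free_monoid :: "'a free_monoid \<Rightarrow> 'a free_monoid \<Rightarrow> 'a free_monoid" where
  "v + w = Letters (letters v @ letters w)"

instance
  by standard (simp_all add: zero_free_monoid_def plus_free_monoid_def)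

end

type_synonym ('g, 'k) free_alg = "'g free_monoid \<Rightarrow>\<^sub>0 'k"

definition gen :: "'g \<Rightarrow> ('g, 'k::comm_ring_1) free_alg" where
  "gen g = Poly_Mapping.single (Letters [g]) 1"

definition const :: "'k::comm_ring_1 \<Rightarrow> ('g, 'k) free_alg" where
  "const c = Poly_Mapping.single 0 c"

definition poly_at :: "'k::comm_ring_1 poly \<Rightarrow> ('g, 'k) free_alg \<Rightarrow> ('g, 'k) free_alg" where
  "poly_at p x = (\<Sum>i\<le>Polynomial.degree p. const (Polynomial.coeff p i) * x ^ i)"

definition free_alg_ring :: "('g, 'k::comm_ring_1) free_alg ring" where
  "free_alg_ring = \<lparr>carrier = UNIV, mult = (*), one = 1, zero = 0, add = (+)\<rparr>"

lemma ring_free_alg_ring: "ring (free_alg_ring :: ('g, 'k::comm_ring_1) free_alg ring)"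
proof (rule ringI)
  show "abelian_group (free_alg_ring :: ('g, 'k) free_alg ring)"
  proof (rule abelian_groupI)
    fix x :: "('g, 'k) free_alg"
    show "\<exists>y\<in>carrier free_alg_ring. y \<oplus>\<^bsub>free_alg_ring\<^esub> x = \<zero>\<^bsub>free_alg_ring\<^esub>"
      by (rule bexI[of _ "- x"]) (simp_all add: free_alg_ring_def)
  qed (simp_all add: free_alg_ring_def add.assoc add.commute)
  show "Group.monoid (free_alg_ring :: ('g, 'k) free_alg ring)"
    by (rule monoidI) (simp_all add: free_alg_ring_def mult.assoc)
qed (simp_all add: free_alg_ring_def distrib_left distrib_right)


section \<open>Algebras given by generators and relations\<close>

text \<open>
  The locale \<^locale>\<open>algebra\<close> only covers commutative algebras, so just the record type
  \<^typ>\<open>('a, 'b) module\<close> is used. The ideal \<^term>\<open>Idl\<^bsub>R\<^esub> S\<close> is two-sided. A scalar acts on the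
  quotient as multiplication by the class of the corresponding constant.
\<close>

definition presented_algebra ::
    "('g, 'k::comm_ring_1) free_alg set \<Rightarrow> ('k, ('g, 'k) free_alg set) module" where
  "presented_algebra S =
    (let F = free_alg_ring; I = Idl\<^bsub>F\<^esub> S; Q = F Quot I
     in ring.extend Q \<lparr>smult = (\<lambda>c X. (I +>\<^bsub>F\<^esub> const c) \<otimes>\<^bsub>Q\<^esub> X)\<rparr>)"

lemma ideal_genideal_free_alg_ring:
  "ideal (Idl\<^bsub>free_alg_ring\<^esub> S) (free_alg_ring :: ('g, 'k::comm_ring_1) free_alg ring)"
  by (rule ring.genideal_ideal[OF ring_free_alg_ring]) (simp add: free_alg_ring_def)

lemma ring_presented_algebra: "ring (presented_algebra S)"
proof -
  interpret Q: ring "free_alg_ring Quot (Idl\<^bsub>free_alg_ring\<^esub> S)"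
    by (rule ideal.quotient_is_ring[OF ideal_genideal_free_alg_ring])
  have "abelian_group (presented_algebra S)"
    by (rule abelian_groupI)
      (use Q.add.l_inv_ex in \<open>auto simp: presented_algebra_def Let_def ring.defs Q.a_ac\<close>)
  moreover have "Group.monoid (presented_algebra S)"
    by (rule monoidI) (simp_all add: presented_algebra_def Let_def ring.defs Q.m_assoc)
  ultimately show ?thesis
    by (rule ringI) (simp_all add: presented_algebra_def Let_def ring.defs Q.l_distr Q.r_distr)
qed

lemma smult_presented_algebra:
  "c \<odot>\<^bsub>presented_algebra S\<^esub> (Idl\<^bsub>free_alg_ring\<^esub> S +>\<^bsub>free_alg_ring\<^esub> x) =
   Idl\<^bsub>free_alg_ring\<^esub> S +>\<^bsub>free_alg_ring\<^esub> (const c * x)"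
proof -
  have "rcoset_mult free_alg_ring (Idl\<^bsub>free_alg_ring\<^esub> S)
      (Idl\<^bsub>free_alg_ring\<^esub> S +>\<^bsub>free_alg_ring\<^esub> const c) (Idl\<^bsub>free_alg_ring\<^esub> S +>\<^bsub>free_alg_ring\<^esub> x) =
      Idl\<^bsub>free_alg_ring\<^esub> S +>\<^bsub>free_alg_ring\<^esub> (const c \<otimes>\<^bsub>free_alg_ring\<^esub> x)"
    by (rule ideal.rcoset_mult_add[OF ideal_genideal_free_alg_ring]) (simp_all add: free_alg_ring_def)
  then show ?thesis
    by (simp add: presented_algebra_def Let_def ring.defs FactRing_def) (simp add: free_alg_ring_def)
qed

definition algebra_iso :: "('k, 'a) module \<Rightarrow> ('k, 'b) module \<Rightarrow> ('a \<Rightarrow> 'b) set" where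
  "algebra_iso A B =
    {f \<in> ring_iso A B. \<forall>c. \<forall>x\<in>carrier A. f (c \<odot>\<^bsub>A\<^esub> x) = c \<odot>\<^bsub>B\<^esub> f x}"

definition algebra_isomorphic :: "('k, 'a) module \<Rightarrow> ('k, 'b) module \<Rightarrow> bool"
    (infix \<open>\<cong>\<^sub>a\<^sub>l\<^sub>g\<close> 50) where
  "A \<cong>\<^sub>a\<^sub>l\<^sub>g B \<longleftrightarrow> algebra_iso A B \<noteq> {}"


section \<open>Generalized down-up algebras\<close>

datatype udt = Gen_u | Gen_d | Gen_t

definition down_up_relators ::
    "'k::comm_ring_1 \<Rightarrow> 'k \<Rightarrow> 'k poly \<Rightarrow> (udt, 'k) free_alg set" where
  "down_up_relators r s \<phi> =
    (let u = gen Gen_u; d = gen Gen_d; t = gen Gen_t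
     in {t * u - u * t,
         t * d - d * t,
         d^2 * u - const (r + s) * d * u * d + const (r * s) * u * d^2 - poly_at \<phi> t * d,
         d * u^2 - const (r + s) * u * d * u + const (r * s) * u^2 * d - poly_at \<phi> t * u})"

definition down_up_algebra ::
    "'k::field \<Rightarrow> 'k \<Rightarrow> 'k poly \<Rightarrow> ('k, (udt, 'k) free_alg set) module" where
  "down_up_algebra r s \<phi> = presented_algebra (down_up_relators r s \<phi>)"


section \<open>Parameters\<close>

definition root_of_unity :: "'k::field \<Rightarrow> bool" where
  "root_of_unity x \<longleftrightarrow> (\<exists>n::nat. n > 0 \<and> x ^ n = 1)"

definition admissible :: "'k::field \<Rightarrow> bool" where
  "admissible x \<longleftrightarrow> x \<noteq> 0 \<and> \<not> root_of_unity x"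

definition mult_independent :: "'k::field \<Rightarrow> 'k \<Rightarrow> bool" where
  "mult_independent r s \<longleftrightarrow> (\<forall>i j :: int. r powi i * s powi j = 1 \<longrightarrow> i = 0 \<and> j = 0)"

text \<open>\<open>\<phi>(at + b) = \<eta> \<psi>(t)\<close> with \<open>a\<close> and \<open>\<eta>\<close> nonzero.\<close>

definition affine_equiv :: "'k::field poly \<Rightarrow> 'k poly \<Rightarrow> bool" where
  "affine_equiv \<phi> \<psi> \<longleftrightarrow>
    (\<exists>\<eta> a b. \<eta> \<noteq> 0 \<and> a \<noteq> 0 \<and> pcompose \<phi> [:b, a:] = Polynomial.smult \<eta> \<psi>)"

end

theory Submission
  imports Defs
begin

text \<open>
  Both \<open>\<phi>\<close> and the parameters can be read off from the characters of
  \<open>A(r, s, \<phi>)\<close>, its homomorphisms to commutative algebras, and from the extensions of one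
  character by another, its homomorphisms to upper triangular \<open>2 \<times> 2\<close> matrices. An isomorphism
  transports both kinds of data, and no basis of the algebra is needed to compute them.

  A triple \<open>(U, D, T)\<close> is the image of \<open>(u, d, t)\<close> under a character iff
  \<open>E = (1 - r) (1 - s) U D - \<phi>(T)\<close> satisfies \<open>E D = E U = 0\<close>. So the characters form the line
  \<open>u = d = 0\<close> and the surface \<open>(1 - r) (1 - s) u d = \<phi>(t)\<close>. For \<open>\<phi> \<noteq> 0\<close> the line has
  one-dimensional tangent spaces generically, while every point of the surface has tangent vectors
  in at least two independent directions; hence an isomorphism maps line to line
  (\<open>line_preserved\<close>) and induces a substitution \<open>t \<mapsto> a t + b\<close> on its coordinate ring. The
  conormal module of the line is \<open>(K[t] / \<phi>)\<^sup>2\<close>, so this substitution matches the ideals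
  generated by the two polynomials (\<open>conormal_dvd\<close>). This determines \<open>\<phi>\<close> up to affine
  equivalence for all \<open>r, s \<noteq> 1\<close>.

  For the parameters, restrict to the curve \<open>d = z, u = p / z, t = 0\<close> of characters. For
  \<open>q \<in> {r, s}\<close> there is a nonsplit extension between the characters at \<open>z\<close> and at \<open>z / q\<close>. Pulled
  back along an isomorphism, the curve becomes a triple of Laurent polynomials \<open>U, D, T\<close>, and the
  existence of nonsplit extensions forces \<open>D(z) = c D(z / q)\<close> with \<open>c \<in> {r', s'}\<close>, and similarly
  for \<open>U\<close> (\<open>curve_skew_equations\<close>). As \<open>q\<close> is not a root of unity, \<open>D\<close> and \<open>U\<close> are monomials, and
  since \<open>z\<close> lies in the image of the pulled back character, their exponents are \<open>\<plusminus> 1\<close>. So \<open>r\<close> and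
  \<open>s\<close>, or their inverses, both lie in \<open>{r', s'}\<close>; for \<open>r \<noteq> s\<close> this determines the pair.

  Conversely, rescaling \<open>u\<close>, affine substitutions in \<open>t\<close> and the exchange of \<open>u\<close> and \<open>d\<close>, which
  inverts \<open>r\<close> and \<open>s\<close>, provide all isomorphisms that are claimed to exist.
\<close>

section \<open>Homomorphisms from free algebras\<close>

text \<open>
  Homomorphisms are studied into rings given by type classes, so ideals are needed there too, and
  not only for the record-based ring of the free algebra.
\<close>

definition two_sided_ideal :: "'c::ring_1 set \<Rightarrow> bool" where
  "two_sided_ideal J \<longleftrightarrow> 0 \<in> J \<and> (\<forall>x\<in>J. \<forall>y\<in>J. x + y \<in> J) \<and> (\<forall>x\<in>J. \<forall>a. a * x \<in> J \<and> x * a \<in> J)"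

lemma two_sided_idealI:
  assumes "0 \<in> J" "\<And>x y. x \<in> J \<Longrightarrow> y \<in> J \<Longrightarrow> x + y \<in> J"
    "\<And>a x. x \<in> J \<Longrightarrow> a * x \<in> J" "\<And>a x. x \<in> J \<Longrightarrow> x * a \<in> J"
  shows "two_sided_ideal J"
  using assms by (simp add: two_sided_ideal_def)

context
  fixes J :: "'c::ring_1 set"
  assumes J: "two_sided_ideal J"
begin

lemma two_sided_ideal_zero: "0 \<in> J"
  and two_sided_ideal_add: "x \<in> J \<Longrightarrow> y \<in> J \<Longrightarrow> x + y \<in> J"
  and two_sided_ideal_mult_left: "x \<in> J \<Longrightarrow> a * x \<in> J"
  and two_sided_ideal_mult_right: "x \<in> J \<Longrightarrow> x * a \<in> J"
  using J by (auto simp: two_sided_ideal_def)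

lemma two_sided_ideal_uminus: "x \<in> J \<Longrightarrow> - x \<in> J"
  using two_sided_ideal_mult_left[of x "- 1"] by simp

lemma two_sided_ideal_diff_trans: "x - y \<in> J \<Longrightarrow> y - z \<in> J \<Longrightarrow> x - z \<in> J"
  using two_sided_ideal_add[of "x - y" "y - z"] by simp

end

lemma two_sided_ideal_singleton_zero: "two_sided_ideal {0 :: 'c::ring_1}"
  by (rule two_sided_idealI) auto

text \<open>
  The structure map of an algebra over \<^typ>\<open>'k\<close>. It has to be a parameter, as a type class
  cannot depend on the type of scalars.
\<close>

locale central_scalars =
  fixes \<kappa> :: "'k::comm_ring_1 \<Rightarrow> 'c::ring_1"
  assumes scalar_one: "\<kappa> 1 = 1"
    and scalar_add: "\<kappa> (a + b) = \<kappa> a + \<kappa> b"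
    and scalar_mult: "\<kappa> (a * b) = \<kappa> a * \<kappa> b"
    and scalar_commute: "\<kappa> a * x = x * \<kappa> a"
begin

lemma scalar_zero: "\<kappa> 0 = 0"
  using scalar_add[of 0 0] by simp

lemma scalar_minus: "\<kappa> (- a) = - \<kappa> a"
  using scalar_add[of a "- a"] by (simp add: scalar_zero eq_neg_iff_add_eq_0 add.commute)

lemma scalar_diff: "\<kappa> (a - b) = \<kappa> a - \<kappa> b"
  using scalar_add[of a "- b"] by (simp add: scalar_minus)

end

locale algebra_hom = central_scalars \<kappa>
  for \<kappa> :: "'k::comm_ring_1 \<Rightarrow> 'c::ring_1" and h :: "('g, 'k) free_alg \<Rightarrow> 'c" +
  assumes hom_const: "h (const c) = \<kappa> c"
    and hom_add: "h (x + y) = h x + h y"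
    and hom_mult: "h (x * y) = h x * h y"
begin

lemma hom_zero: "h 0 = 0"
  using hom_add[of 0 0] by simp

lemma hom_uminus: "h (- x) = - h x"
  using hom_add[of x "- x"] by (simp add: hom_zero eq_neg_iff_add_eq_0 add.commute)

lemma hom_diff: "h (x - y) = h x - h y"
  using hom_add[of x "- y"] by (simp add: hom_uminus)

lemma hom_one: "h 1 = 1"
  using hom_const[of 1] by (simp add: const_def scalar_one)

lemma hom_power: "h (x ^ n) = h x ^ n"
  by (induction n) (simp_all add: hom_one hom_mult)

lemma hom_sum: "h (sum f A) = (\<Sum>a\<in>A. h (f a))"
  by (induction A rule: infinite_finite_induct) (simp_all add: hom_zero hom_add)

end

lemma poly_mapping_single_induct [case_names zero single_add]:
  fixes x :: "'a \<Rightarrow>\<^sub>0 'b::ab_group_add"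
  assumes "P 0" "\<And>w c y. P y \<Longrightarrow> P (Poly_Mapping.single w c + y)"
  shows "P x"
proof (induction x rule: update_induct)
  case const
  show ?case using assms(1) by simp
next
  case (update f a b)
  have "Poly_Mapping.update a b f = Poly_Mapping.single a b + f"
  proof (rule poly_mapping_eqI)
    fix k
    show "Poly_Mapping.lookup (Poly_Mapping.update a b f) k =
        Poly_Mapping.lookup (Poly_Mapping.single a b + f) k"
      using update(1) by (cases "k = a") (simp_all add: lookup_update lookup_add lookup_single in_keys_iff)
  qed
  then show ?case using assms(2) update by simp
qed

lemma single_eq_const_mult_gens:
  "(Poly_Mapping.single (Letters gs) c :: ('a, 'b::comm_ring_1) free_alg) = const c * prod_list (map gen gs)"
proof -
  have one: "(1 :: ('a, 'b) free_alg) = Poly_Mapping.single (Letters []) 1"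
    by (simp only: zero_free_monoid_def[symmetric] single_one)
  have "prod_list (map gen gs) = (Poly_Mapping.single (Letters gs) 1 :: ('a, 'b) free_alg)" for gs
    by (induction gs) (simp_all add: one gen_def mult_single plus_free_monoid_def)
  then show ?thesis by (simp add: const_def mult_single)
qed

lemma free_alg_induct [case_names const gen add mult]:
  fixes x :: "('g, 'k::comm_ring_1) free_alg"
  assumes const: "\<And>c. P (const c)" and gen: "\<And>g. P (gen g)"
    and add: "\<And>x y. P x \<Longrightarrow> P y \<Longrightarrow> P (x + y)" and mult: "\<And>x y. P x \<Longrightarrow> P y \<Longrightarrow> P (x * y)"
  shows "P x"
proof (induction x rule: poly_mapping_single_induct)
  case zero
  show ?case using const[of 0] by (simp add: const_def)
next
  case (single_add w c y)
  have "P (prod_list (map gen gs))" for gs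
  proof (induction gs)
    case Nil
    show ?case using const[of 1] by (simp add: const_def)
  qed (simp add: mult gen)
  then have "P (Poly_Mapping.single w c)"
    using single_eq_const_mult_gens[of "letters w" c] by (simp add: mult const)
  then show ?case by (rule add) fact
qed

text \<open>
  Agreement modulo an ideal is what the directions normal to the line of characters require;
  the zero ideal gives the uniqueness part of the universal property.
\<close>

lemma algebra_hom_cong_ideal:
  fixes h h' :: "('g, 'k::comm_ring_1) free_alg \<Rightarrow> 'c::ring_1"
  assumes "algebra_hom \<kappa> h" "algebra_hom \<kappa> h'" and J: "two_sided_ideal J"
    and gens: "\<And>g. h (gen g) - h' (gen g) \<in> J"
  shows "h x - h' x \<in> J"
proof -
  interpret h: algebra_hom \<kappa> h by fact
  interpret h': algebra_hom \<kappa> h' by fact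
  show ?thesis
  proof (induction x rule: free_alg_induct)
    case (const c)
    show ?case by (simp add: h.hom_const h'.hom_const two_sided_ideal_zero[OF J])
  next
    case (gen g)
    show ?case by (rule gens)
  next
    case (add x y)
    then show ?case
      using two_sided_ideal_add[OF J add] by (simp add: h.hom_add h'.hom_add algebra_simps)
  next
    case (mult x y)
    have "h (x * y) - h' (x * y) = (h x - h' x) * h y + h' x * (h y - h' y)"
      by (simp add: h.hom_mult h'.hom_mult algebra_simps)
    then show ?case
      using mult J by (simp add: two_sided_ideal_add two_sided_ideal_mult_left two_sided_ideal_mult_right)
  qed
qed

lemma algebra_hom_ext:
  assumes "algebra_hom \<kappa> h" "algebra_hom \<kappa> h'" and "\<And>g. h (gen g) = h' (gen g)"
  shows "h x = h' x"
proof -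
  have "h x - h' x \<in> {0}"
    by (rule algebra_hom_cong_ideal[OF assms(1,2) two_sided_ideal_singleton_zero]) (simp add: assms(3))
  then show ?thesis by simp
qed

lemma central_scalars_const: "central_scalars (const :: 'k::comm_ring_1 \<Rightarrow> ('g, 'k) free_alg)"
proof
  fix c :: 'k and x :: "('g, 'k) free_alg"
  show "const c * x = x * const c"
  proof (induction x rule: poly_mapping_single_induct)
    case (single_add w d y)
    then show ?case by (simp add: const_def distrib_left distrib_right mult_single mult.commute)
  qed simp
qed (simp_all add: const_def mult_single single_add)

lemma algebra_hom_id: "algebra_hom const (\<lambda>x. x)"
  by (simp add: algebra_hom_def algebra_hom_axioms_def central_scalars_const)

lemma algebra_hom_compose:
  "algebra_hom const F \<Longrightarrow> algebra_hom \<kappa> h \<Longrightarrow> algebra_hom \<kappa> (\<lambda>x. h (F x))"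
  by (simp add: algebra_hom_def algebra_hom_axioms_def)

definition free_eval :: "('k::comm_ring_1 \<Rightarrow> 'c::ring_1) \<Rightarrow> ('g \<Rightarrow> 'c) \<Rightarrow> ('g, 'k) free_alg \<Rightarrow> 'c" where
  "free_eval \<kappa> g x = (\<Sum>w. \<kappa> (Poly_Mapping.lookup x w) * prod_list (map g (letters w)))"

context central_scalars
begin

lemma free_eval_add: "free_eval \<kappa> g (x + y) = free_eval \<kappa> g x + free_eval \<kappa> g y"
proof -
  have "finite {w. \<kappa> (Poly_Mapping.lookup z w) * prod_list (map g (letters w)) \<noteq> 0}" for z
    by (rule finite_subset[OF _ finite_keys[of z]]) (auto simp: in_keys_iff scalar_zero)
  then show ?thesis
    by (simp add: free_eval_def lookup_add scalar_add distrib_right Sum_any.distrib)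
qed

lemma free_eval_single:
  "free_eval \<kappa> g (Poly_Mapping.single w c) = \<kappa> c * prod_list (map g (letters w))"
proof -
  have "(\<lambda>v. \<kappa> (Poly_Mapping.lookup (Poly_Mapping.single w c) v) * prod_list (map g (letters v))) =
      (\<lambda>v. \<kappa> c * prod_list (map g (letters v)) when v = w)"
    by (auto simp: lookup_single when_def scalar_zero)
  then show ?thesis by (simp only: free_eval_def Sum_any_when_equal)
qed

lemma free_eval_zero: "free_eval \<kappa> g 0 = 0"
  using free_eval_add[of g 0 0] by simp

lemma free_eval_gen: "free_eval \<kappa> g (gen a) = g a"
  by (simp add: gen_def free_eval_single scalar_one)

lemma algebra_hom_free_eval: "algebra_hom \<kappa> (free_eval \<kappa> g)"
proof
  show "free_eval \<kappa> g (const c) = \<kappa> c" for c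
    by (simp add: const_def free_eval_single zero_free_monoid_def)
  show "free_eval \<kappa> g (x + y) = free_eval \<kappa> g x + free_eval \<kappa> g y" for x y
    by (rule free_eval_add)
  have single: "free_eval \<kappa> g (Poly_Mapping.single v c * y) =
      free_eval \<kappa> g (Poly_Mapping.single v c) * free_eval \<kappa> g y" for v c y
  proof (induction y rule: poly_mapping_single_induct)
    case (single_add w d y)
    have "\<kappa> c * \<kappa> d * (prod_list (map g (letters v)) * prod_list (map g (letters w))) =
        \<kappa> c * prod_list (map g (letters v)) * (\<kappa> d * prod_list (map g (letters w)))"
      by (metis mult.assoc scalar_commute)
    then show ?case
      using single_add by (simp add: distrib_left free_eval_add mult_single free_eval_single
        scalar_mult plus_free_monoid_def)
  qed (simp add: free_eval_zero)
  show "free_eval \<kappa> g (x * y) = free_eval \<kappa> g x * free_eval \<kappa> g y" for x y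
    by (induction x rule: poly_mapping_single_induct)
      (simp_all add: free_eval_zero distrib_right free_eval_add single)
qed

end

section \<open>Isomorphisms of presented algebras\<close>

abbreviation relation_ideal :: "('g, 'k::comm_ring_1) free_alg set \<Rightarrow> ('g, 'k) free_alg set" where
  "relation_ideal S \<equiv> Idl\<^bsub>free_alg_ring\<^esub> S"

lemma ideal_iff_two_sided_ideal:
  "ideal J (free_alg_ring :: ('g, 'k::comm_ring_1) free_alg ring) \<longleftrightarrow> two_sided_ideal J"
proof
  assume "ideal J (free_alg_ring :: ('g, 'k) free_alg ring)"
  then interpret ideal J "free_alg_ring :: ('g, 'k) free_alg ring" .
  show "two_sided_ideal J"
    using additive_subgroup.zero_closed[OF is_additive_subgroup]
      additive_subgroup.a_closed[OF is_additive_subgroup] I_l_closed I_r_closed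
    by (intro two_sided_idealI) (simp_all add: free_alg_ring_def)
next
  assume J: "two_sided_ideal J"
  show "ideal J (free_alg_ring :: ('g, 'k) free_alg ring)"
  proof (rule idealI[OF ring_free_alg_ring])
    interpret ring "free_alg_ring :: ('g, 'k) free_alg ring" by (rule ring_free_alg_ring)
    show "subgroup J (add_monoid (free_alg_ring :: ('g, 'k) free_alg ring))"
    proof
      fix x assume "x \<in> J"
      moreover have "inv\<^bsub>add_monoid (free_alg_ring :: ('g, 'k) free_alg ring)\<^esub> x = - x"
        unfolding a_inv_def[symmetric] by (rule minus_equality) (simp_all add: free_alg_ring_def)
      ultimately show "inv\<^bsub>add_monoid (free_alg_ring :: ('g, 'k) free_alg ring)\<^esub> x \<in> J"
        by (simp add: two_sided_ideal_uminus[OF J])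
    qed (use J in \<open>auto simp: free_alg_ring_def two_sided_ideal_zero two_sided_ideal_add\<close>)
  qed (use J in \<open>auto simp: free_alg_ring_def two_sided_ideal_mult_left two_sided_ideal_mult_right\<close>)
qed

lemma two_sided_ideal_relation_ideal: "two_sided_ideal (relation_ideal S)"
  using ideal_genideal_free_alg_ring ideal_iff_two_sided_ideal by blast

lemma relation_ideal_superset: "S \<subseteq> relation_ideal S"
  by (rule ring.genideal_self[OF ring_free_alg_ring]) (simp add: free_alg_ring_def)

lemma (in algebra_hom) hom_relation_ideal:
  assumes J: "two_sided_ideal J" and "h ` S \<subseteq> J" and "x \<in> relation_ideal S"
  shows "h x \<in> J"
proof -
  have "two_sided_ideal {x. h x \<in> J}"
    using J by (intro two_sided_idealI) (auto simp: hom_zero hom_add hom_mult two_sided_ideal_zero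
      two_sided_ideal_add two_sided_ideal_mult_left two_sided_ideal_mult_right)
  then have "relation_ideal S \<subseteq> {x. h x \<in> J}"
    using assms(2) by (intro ring.genideal_minimal[OF ring_free_alg_ring]) (auto simp: ideal_iff_two_sided_ideal)
  with assms(3) show ?thesis by auto
qed

abbreviation quot_class :: "('g, 'k::comm_ring_1) free_alg set \<Rightarrow> ('g, 'k) free_alg \<Rightarrow> ('g, 'k) free_alg set" where
  "quot_class S x \<equiv> relation_ideal S +>\<^bsub>free_alg_ring\<^esub> x"

lemma quot_class_eq_iff: "quot_class S x = quot_class S y \<longleftrightarrow> x - y \<in> relation_ideal S"
proof -
  note J = two_sided_ideal_relation_ideal[of S]
  have cls: "quot_class S x = {i + x |i. i \<in> relation_ideal S}" for x
    by (auto simp: a_r_coset_def r_coset_def free_alg_ring_def)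
  show ?thesis
  proof
    assume "quot_class S x = quot_class S y"
    moreover have "x \<in> quot_class S x" unfolding cls using two_sided_ideal_zero[OF J] by force
    ultimately show "x - y \<in> relation_ideal S" unfolding cls by auto
  next
    have sub: "quot_class S x \<subseteq> quot_class S y" if "x - y \<in> relation_ideal S" for x y
    proof
      fix z assume "z \<in> quot_class S x"
      then obtain i where "i \<in> relation_ideal S" "z = i + x" unfolding cls by auto
      then have "z = (i + (x - y)) + y" "i + (x - y) \<in> relation_ideal S"
        using that two_sided_ideal_add[OF J] by auto
      then show "z \<in> quot_class S y" unfolding cls by blast
    qed
    assume "x - y \<in> relation_ideal S"
    moreover from this have "y - x \<in> relation_ideal S" using two_sided_ideal_uminus[OF J] by fastforce
    ultimately show "quot_class S x = quot_class S y" using sub by blast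
  qed
qed

lemma carrier_presented_algebra: "carrier (presented_algebra S) = range (quot_class S)"
  by (auto simp: presented_algebra_def Let_def ring.defs FactRing_def A_RCOSETS_def RCOSETS_def
      a_r_coset_def free_alg_ring_def)

lemma one_presented_algebra: "\<one>\<^bsub>presented_algebra S\<^esub> = quot_class S 1"
  by (simp add: presented_algebra_def Let_def ring.defs FactRing_def) (simp add: free_alg_ring_def)

lemma mult_presented_algebra:
  "quot_class S x \<otimes>\<^bsub>presented_algebra S\<^esub> quot_class S y = quot_class S (x * y)"
  using ideal.rcoset_mult_add[OF ideal_genideal_free_alg_ring, of x y S]
  by (simp add: presented_algebra_def Let_def ring.defs FactRing_def) (simp add: free_alg_ring_def)

lemma add_presented_algebra:
  "quot_class S x \<oplus>\<^bsub>presented_algebra S\<^esub> quot_class S y = quot_class S (x + y)"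
  using ideal.a_rcos_sum[OF ideal_genideal_free_alg_ring, of x y S]
  by (simp add: presented_algebra_def Let_def ring.defs FactRing_def) (simp add: free_alg_ring_def)

text \<open>
  An isomorphism of the presented algebras, lifted to the free algebras. The two substitutions
  are inverse to each other only modulo the relations.
\<close>

definition inverse_substitutions ::
    "('g, 'k::comm_ring_1) free_alg set \<Rightarrow> ('h, 'k) free_alg set \<Rightarrow>
      (('g, 'k) free_alg \<Rightarrow> ('h, 'k) free_alg) \<Rightarrow> (('h, 'k) free_alg \<Rightarrow> ('g, 'k) free_alg) \<Rightarrow> bool" where
  "inverse_substitutions S S' F G \<longleftrightarrow>
    algebra_hom const F \<and> algebra_hom const G \<and>
    F ` S \<subseteq> relation_ideal S' \<and> G ` S' \<subseteq> relation_ideal S \<and>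
    (\<forall>x. G (F x) - x \<in> relation_ideal S) \<and> (\<forall>y. F (G y) - y \<in> relation_ideal S')"

lemma inverse_substitutions_sym: "inverse_substitutions S S' F G \<Longrightarrow> inverse_substitutions S' S G F"
  by (auto simp: inverse_substitutions_def)

lemma inverse_substitutions_relation_ideal:
  assumes "inverse_substitutions S S' F G" and "x \<in> relation_ideal S"
  shows "F x \<in> relation_ideal S'"
  using assms algebra_hom.hom_relation_ideal[OF _ two_sided_ideal_relation_ideal]
  by (metis inverse_substitutions_def)

lemma inverse_substitutionsI:
  assumes F: "algebra_hom const F" and G: "algebra_hom const G"
    and "F ` S \<subseteq> relation_ideal S'" "G ` S' \<subseteq> relation_ideal S"
    and "\<And>g. G (F (gen g)) = gen g" "\<And>g. F (G (gen g)) = gen g"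
  shows "inverse_substitutions S S' F G"
proof -
  have "G (F x) = x" for x
    using algebra_hom_ext[OF algebra_hom_compose[OF F G] algebra_hom_id] assms(5) by blast
  moreover have "F (G x) = x" for x
    using algebra_hom_ext[OF algebra_hom_compose[OF G F] algebra_hom_id] assms(6) by blast
  ultimately show ?thesis
    using assms
    by (auto simp: inverse_substitutions_def two_sided_ideal_zero[OF two_sided_ideal_relation_ideal])
qed

lemma inverse_substitutions_trans:
  assumes 1: "inverse_substitutions S S' F G" and 2: "inverse_substitutions S' S'' F' G'"
  shows "inverse_substitutions S S'' (\<lambda>x. F' (F x)) (\<lambda>x. G (G' x))"
proof -
  note sym = inverse_substitutions_sym[OF 1]
  note homs = 1[unfolded inverse_substitutions_def] 2[unfolded inverse_substitutions_def]
  have "G (G' (F' (F x))) - x \<in> relation_ideal S" for x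
  proof -
    have "G (G' (F' (F x)) - F x) \<in> relation_ideal S"
      by (rule inverse_substitutions_relation_ideal[OF sym]) (use homs in blast)
    then have "G (G' (F' (F x))) - G (F x) \<in> relation_ideal S"
      using homs algebra_hom.hom_diff[of const G] by simp
    moreover have "G (F x) - x \<in> relation_ideal S" using homs by blast
    ultimately show ?thesis
      by (rule two_sided_ideal_diff_trans[OF two_sided_ideal_relation_ideal])
  qed
  moreover have "F' (F (G (G' x))) - x \<in> relation_ideal S''" for x
  proof -
    have "F' (F (G (G' x)) - G' x) \<in> relation_ideal S''"
      by (rule inverse_substitutions_relation_ideal[OF 2]) (use homs in blast)
    then have "F' (F (G (G' x))) - F' (G' x) \<in> relation_ideal S''"
      using homs algebra_hom.hom_diff[of const F'] by simp
    moreover have "F' (G' x) - x \<in> relation_ideal S''" using homs by blast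
    ultimately show ?thesis
      by (rule two_sided_ideal_diff_trans[OF two_sided_ideal_relation_ideal])
  qed
  moreover have "(\<lambda>x. F' (F x)) ` S \<subseteq> relation_ideal S''"
    using homs inverse_substitutions_relation_ideal[OF 2] by auto
  moreover have "(\<lambda>x. G (G' x)) ` S'' \<subseteq> relation_ideal S"
    using homs inverse_substitutions_relation_ideal[OF sym] by auto
  ultimately show ?thesis
    using homs by (auto simp: inverse_substitutions_def intro: algebra_hom_compose)
qed

text \<open>A lift is obtained by choosing representatives of the images of the generators.\<close>

lemma algebra_iso_lift:
  assumes f: "f \<in> algebra_iso (presented_algebra S) (presented_algebra S')"
  obtains F where "algebra_hom const F" "\<And>x. f (quot_class S x) = quot_class S' (F x)"
proof -
  let ?A = "presented_algebra S" and ?B = "presented_algebra S'"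
  have iso: "f \<in> ring_iso ?A ?B" and smult: "\<And>c x. x \<in> carrier ?A \<Longrightarrow> f (c \<odot>\<^bsub>?A\<^esub> x) = c \<odot>\<^bsub>?B\<^esub> f x"
    using f by (auto simp: algebra_iso_def)
  have carr: "quot_class S x \<in> carrier ?A" for x by (simp add: carrier_presented_algebra)
  have "\<exists>y. f (quot_class S (gen g)) = quot_class S' y" for g
    using ring_iso_memE(1)[OF iso carr] by (auto simp: carrier_presented_algebra)
  then obtain F0 where F0: "\<And>g. f (quot_class S (gen g)) = quot_class S' (F0 g)" by metis
  define F where "F = free_eval const F0"
  interpret F: algebra_hom const F
    unfolding F_def by (rule central_scalars.algebra_hom_free_eval[OF central_scalars_const])
  have "f (quot_class S x) = quot_class S' (F x)" for x
  proof (induction x rule: free_alg_induct)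
    case (const c)
    have "quot_class S (const c) = c \<odot>\<^bsub>?A\<^esub> \<one>\<^bsub>?A\<^esub>"
      by (simp add: one_presented_algebra smult_presented_algebra)
    also have "f \<dots> = c \<odot>\<^bsub>?B\<^esub> \<one>\<^bsub>?B\<^esub>"
      using smult[of "\<one>\<^bsub>?A\<^esub>"] carr ring_iso_memE(4)[OF iso] by (simp add: one_presented_algebra)
    also have "\<dots> = quot_class S' (F (const c))"
      by (simp add: one_presented_algebra smult_presented_algebra F.hom_const)
    finally show ?case .
  next
    case (gen g)
    show ?case
      by (simp add: F0 F_def central_scalars.free_eval_gen[OF central_scalars_const])
  next
    case (add x y)
    then show ?case
      using ring_iso_memE(3)[OF iso carr carr, of x y] by (simp add: add_presented_algebra F.hom_add)
  next
    case (mult x y)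
    then show ?case
      using ring_iso_memE(2)[OF iso carr carr, of x y] by (simp add: mult_presented_algebra F.hom_mult)
  qed
  then show ?thesis using that F.algebra_hom_axioms by blast
qed

lemma induced_map_exists:
  assumes FG: "inverse_substitutions S S' F G"
  shows "\<exists>f. \<forall>x. f (quot_class S x) = quot_class S' (F x)"
proof -
  have "quot_class S' (F x) = quot_class S' (F y)" if "quot_class S x = quot_class S y" for x y
    using that inverse_substitutions_relation_ideal[OF FG, of "x - y"] FG
      algebra_hom.hom_diff[of const F x y]
    by (simp add: quot_class_eq_iff inverse_substitutions_def)
  then have "\<forall>X. \<exists>Y. \<forall>x. X = quot_class S x \<longrightarrow> Y = quot_class S' (F x)" by metis
  then show ?thesis by metis
qed

text \<open>
  From left to right, both lifts are built from the given map alone: the generators of the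
  target have preimages because the map is surjective, and injectivity shows that the lift defined
  by these preimages is also a left inverse. Afterwards no cosets occur any more.
\<close>

lemma presented_algebra_isomorphic_iff:
  "presented_algebra S \<cong>\<^sub>a\<^sub>l\<^sub>g presented_algebra S' \<longleftrightarrow> (\<exists>F G. inverse_substitutions S S' F G)"
proof
  let ?A = "presented_algebra S" and ?B = "presented_algebra S'"
  assume "?A \<cong>\<^sub>a\<^sub>l\<^sub>g ?B"
  then obtain f where f: "f \<in> algebra_iso ?A ?B" by (auto simp: algebra_isomorphic_def)
  have bij: "bij_betw f (carrier ?A) (carrier ?B)"
    using f by (simp add: algebra_iso_def ring_iso_def)
  obtain F where F: "algebra_hom const F" "\<And>x. f (quot_class S x) = quot_class S' (F x)"
    using algebra_iso_lift[OF f] by blast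
  have inj: "quot_class S x = quot_class S y" if "F x - F y \<in> relation_ideal S'" for x y
  proof -
    have "f (quot_class S x) = f (quot_class S y)" using that by (simp add: F(2) quot_class_eq_iff)
    then show ?thesis
      by (rule inj_onD[OF bij_betw_imp_inj_on[OF bij]]) (simp_all add: carrier_presented_algebra)
  qed
  have "\<exists>x. F x - gen g \<in> relation_ideal S'" for g
  proof -
    have "quot_class S' (gen g) \<in> f ` range (quot_class S)"
      using bij_betw_imp_surj_on[OF bij] by (simp add: carrier_presented_algebra)
    then obtain x where "quot_class S' (gen g) = quot_class S' (F x)" by (auto simp: F(2))
    then have "F x - gen g \<in> relation_ideal S'" by (simp flip: quot_class_eq_iff)
    then show ?thesis ..
  qed
  then obtain G0 where G0: "\<And>g. F (G0 g) - gen g \<in> relation_ideal S'"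
    by metis
  define G where "G = free_eval const G0"
  have G: "algebra_hom const G" "\<And>g. G (gen g) = G0 g"
    unfolding G_def by (simp_all add: central_scalars.algebra_hom_free_eval
      central_scalars.free_eval_gen central_scalars_const)
  have FG: "F (G y) - y \<in> relation_ideal S'" for y
    by (rule algebra_hom_cong_ideal[OF algebra_hom_compose[OF G(1) F(1)] algebra_hom_id
        two_sided_ideal_relation_ideal]) (simp add: G(2) G0)
  have GF: "G (F x) - x \<in> relation_ideal S" for x
    using inj[OF FG[of "F x"]] by (simp only: quot_class_eq_iff)
  have zero: "F 0 = 0" by (rule algebra_hom.hom_zero[OF F(1)])
  have "F x \<in> relation_ideal S'" if "x \<in> S" for x
  proof -
    have "quot_class S x = quot_class S 0"
      using that relation_ideal_superset by (auto simp: quot_class_eq_iff)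
    then have "quot_class S' (F x) = quot_class S' (F 0)" by (simp flip: F(2))
    then show ?thesis by (simp add: zero quot_class_eq_iff)
  qed
  moreover have "G y \<in> relation_ideal S" if "y \<in> S'" for y
  proof -
    have "y \<in> relation_ideal S'" using that relation_ideal_superset by blast
    then have "F (G y) - F 0 \<in> relation_ideal S'"
      using two_sided_ideal_add[OF two_sided_ideal_relation_ideal FG[of y], of y] by (simp add: zero)
    then have "quot_class S (G y) = quot_class S 0" by (rule inj)
    then show ?thesis by (simp add: quot_class_eq_iff)
  qed
  ultimately have "inverse_substitutions S S' F G"
    using F(1) G(1) FG GF by (simp add: inverse_substitutions_def image_subset_iff)
  then show "\<exists>F G. inverse_substitutions S S' F G" by blast
next
  let ?A = "presented_algebra S" and ?B = "presented_algebra S'"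
  assume "\<exists>F G. inverse_substitutions S S' F G"
  then obtain F G where FG: "inverse_substitutions S S' F G" by blast
  obtain f where f: "\<And>x. f (quot_class S x) = quot_class S' (F x)"
    using induced_map_exists[OF FG] by blast
  obtain g where g: "\<And>x. g (quot_class S' x) = quot_class S (G x)"
    using induced_map_exists[OF inverse_substitutions_sym[OF FG]] by blast
  interpret F: algebra_hom const F using FG by (simp add: inverse_substitutions_def)
  have "bij_betw f (carrier ?A) (carrier ?B)"
    by (rule bij_betw_byWitness[where f' = g])
      (use FG in \<open>auto simp: carrier_presented_algebra f g quot_class_eq_iff inverse_substitutions_def\<close>)
  then have "f \<in> ring_iso ?A ?B"
    by (intro ring_iso_memI) (auto simp: carrier_presented_algebra f mult_presented_algebra
      add_presented_algebra one_presented_algebra F.hom_mult F.hom_add F.hom_one)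
  then have "f \<in> algebra_iso ?A ?B"
    by (auto simp: algebra_iso_def carrier_presented_algebra smult_presented_algebra f F.hom_mult F.hom_const)
  then show "?A \<cong>\<^sub>a\<^sub>l\<^sub>g ?B" by (auto simp: algebra_isomorphic_def)
qed

section \<open>Evaluation of polynomials\<close>

text \<open>
  The image of \<^const>\<open>poly_at\<close> under a homomorphism into an algebra with structure map \<open>\<kappa>\<close>.
\<close>

definition peval :: "('k::comm_ring_1 \<Rightarrow> 'c::ring_1) \<Rightarrow> 'k poly \<Rightarrow> 'c \<Rightarrow> 'c" where
  "peval \<kappa> p x = (\<Sum>i\<le>Polynomial.degree p. \<kappa> (Polynomial.coeff p i) * x ^ i)"

lemma poly_at_eq_peval: "poly_at p x = peval const p x"
  by (simp add: poly_at_def peval_def)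

lemma (in algebra_hom) hom_peval: "h (peval const p x) = peval \<kappa> p (h x)"
  by (simp add: peval_def hom_sum hom_mult hom_power hom_const)

context central_scalars
begin

lemma peval_altdef:
  assumes "Polynomial.degree p \<le> n"
  shows "peval \<kappa> p x = (\<Sum>i\<le>n. \<kappa> (Polynomial.coeff p i) * x ^ i)"
  unfolding peval_def
  by (rule sum.mono_neutral_left) (use assms in \<open>auto simp: coeff_eq_0 scalar_zero\<close>)

lemma peval_pCons: "peval \<kappa> (pCons a p) x = \<kappa> a + x * peval \<kappa> p x"
proof -
  have "\<kappa> b * (x * y) = x * (\<kappa> b * y)" for b y
    by (metis mult.assoc scalar_commute)
  moreover have "peval \<kappa> (pCons a p) x =
      (\<Sum>i\<le>Suc (Polynomial.degree p). \<kappa> (Polynomial.coeff (pCons a p) i) * x ^ i)"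
    by (rule peval_altdef) (rule degree_pCons_le)
  ultimately show ?thesis
    by (simp add: sum.atMost_Suc_shift peval_def sum_distrib_left del: sum.atMost_Suc)
qed

lemma peval_zero: "peval \<kappa> 0 x = 0"
  by (simp add: peval_def scalar_zero)

lemma peval_add: "peval \<kappa> (p + q) x = peval \<kappa> p x + peval \<kappa> q x"
  by (induction p q rule: poly_induct2) (simp_all add: peval_zero peval_pCons scalar_add algebra_simps)

lemma peval_smult: "peval \<kappa> (Polynomial.smult c p) x = \<kappa> c * peval \<kappa> p x"
proof (induction p)
  case (pCons a p)
  have "\<kappa> c * (x * y) = x * (\<kappa> c * y)" for y
    by (metis mult.assoc scalar_commute)
  with pCons show ?case by (simp add: peval_pCons scalar_mult distrib_left)
qed (simp add: peval_zero)

lemma peval_mult: "peval \<kappa> (p * q) x = peval \<kappa> p x * peval \<kappa> q x"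
  by (induction p) (simp_all add: peval_zero peval_pCons peval_add peval_smult scalar_zero algebra_simps)

lemma peval_pcompose: "peval \<kappa> (pcompose p q) x = peval \<kappa> p (peval \<kappa> q x)"
  by (induction p)
    (simp_all add: peval_zero peval_pCons pcompose_pCons peval_add peval_mult algebra_simps)

end

section \<open>Triangular matrices\<close>

text \<open>
  A homomorphism to triangular matrices consists of two homomorphisms on the diagonal and a skew
  derivation between them in the corner, that is, of an extension of two modules. If the
  diagonal entries coincide, this is a homomorphism to the dual numbers, so a point with a tangent
  vector.
\<close>

datatype 'c tri = Tri (ul: 'c) (ur: 'c) (lr: 'c)

instantiation tri :: (ring_1) ring_1
begin

definition "0 = Tri 0 0 0"
definition "1 = Tri 1 0 1"
definition "x + y = Tri (ul x + ul y) (ur x + ur y) (lr x + lr y)"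
definition "x - y = Tri (ul x - ul y) (ur x - ur y) (lr x - lr y)"
definition "- x = Tri (- ul x) (- ur x) (- lr x)"
definition "x * y = Tri (ul x * ul y) (ul x * ur y + ur x * lr y) (lr x * lr y)"

instance
  by standard (simp_all add: zero_tri_def one_tri_def plus_tri_def minus_tri_def uminus_tri_def
      times_tri_def tri.expand algebra_simps)

end

lemmas tri_simps = zero_tri_def one_tri_def plus_tri_def minus_tri_def uminus_tri_def times_tri_def

definition tri_scalar :: "('k \<Rightarrow> 'c::ring_1) \<Rightarrow> 'k \<Rightarrow> 'c tri" where
  "tri_scalar \<kappa> c = Tri (\<kappa> c) 0 (\<kappa> c)"

lemma (in central_scalars) central_scalars_tri: "central_scalars (tri_scalar \<kappa>)"
proof
  show "tri_scalar \<kappa> a * x = x * tri_scalar \<kappa> a" for a x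
    by (simp add: tri_scalar_def times_tri_def scalar_commute[of _ "ul x"] scalar_commute[of _ "ur x"]
        scalar_commute[of _ "lr x"])
qed (simp_all add: tri_scalar_def tri_simps scalar_one scalar_add scalar_mult)

lemma (in central_scalars) algebra_hom_ul_lr:
  assumes "algebra_hom (tri_scalar \<kappa>) \<Delta>"
  shows "algebra_hom \<kappa> (\<lambda>x. ul (\<Delta> x))" and "algebra_hom \<kappa> (\<lambda>x. lr (\<Delta> x))"
proof -
  interpret \<Delta>: algebra_hom "tri_scalar \<kappa>" \<Delta> by fact
  show "algebra_hom \<kappa> (\<lambda>x. ul (\<Delta> x))" "algebra_hom \<kappa> (\<lambda>x. lr (\<Delta> x))"
    by (unfold_locales; simp add: \<Delta>.hom_const \<Delta>.hom_add \<Delta>.hom_mult tri_simps tri_scalar_def)+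
qed

lemma algebra_hom_triI:
  fixes \<chi> \<chi>' \<delta> :: "('g, 'k::comm_ring_1) free_alg \<Rightarrow> 'c::ring_1"
  assumes "algebra_hom \<kappa> \<chi>" "algebra_hom \<kappa> \<chi>'"
    and "\<And>c. \<delta> (const c) = 0" "\<And>x y. \<delta> (x + y) = \<delta> x + \<delta> y"
    and "\<And>x y. \<delta> (x * y) = \<chi> x * \<delta> y + \<delta> x * \<chi>' y"
  shows "algebra_hom (tri_scalar \<kappa>) (\<lambda>x. Tri (\<chi> x) (\<delta> x) (\<chi>' x))"
proof -
  interpret \<chi>: algebra_hom \<kappa> \<chi> by fact
  interpret \<chi>': algebra_hom \<kappa> \<chi>' by fact
  interpret tri: central_scalars "tri_scalar \<kappa>" by (rule \<chi>.central_scalars_tri)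
  show ?thesis
  proof
    show "Tri (\<chi> (const c)) (\<delta> (const c)) (\<chi>' (const c)) = tri_scalar \<kappa> c" for c
      by (simp add: assms(3) \<chi>.hom_const \<chi>'.hom_const tri_scalar_def)
    show "Tri (\<chi> (x + y)) (\<delta> (x + y)) (\<chi>' (x + y)) =
        Tri (\<chi> x) (\<delta> x) (\<chi>' x) + Tri (\<chi> y) (\<delta> y) (\<chi>' y)" for x y
      by (simp add: assms(4) \<chi>.hom_add \<chi>'.hom_add plus_tri_def)
    show "Tri (\<chi> (x * y)) (\<delta> (x * y)) (\<chi>' (x * y)) =
        Tri (\<chi> x) (\<delta> x) (\<chi>' x) * Tri (\<chi> y) (\<delta> y) (\<chi>' y)" for x y
      by (simp add: assms(5) \<chi>.hom_mult \<chi>'.hom_mult times_tri_def)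
  qed
qed

lemma (in central_scalars) peval_tri_diagonal:
  "peval (tri_scalar \<kappa>) p (Tri x 0 y) = Tri (peval \<kappa> p x) 0 (peval \<kappa> p y)"
proof -
  interpret tri: central_scalars "tri_scalar \<kappa>" by (rule central_scalars_tri)
  show ?thesis
  proof (induction p)
    case (pCons a p)
    have "peval (tri_scalar \<kappa>) (pCons a p) (Tri x 0 y) = tri_scalar \<kappa> a + Tri x 0 y *  peval (tri_scalar \<kappa>) p (Tri x 0 y)"
      by (rule tri.peval_pCons)
    also have "\<dots> = Tri (\<kappa> a) 0 (\<kappa> a) + Tri x 0 y * Tri (peval \<kappa> p x) 0 (peval \<kappa> p y)"
      by (simp only: pCons.IH tri_scalar_def)
    also have "\<dots> = Tri (\<kappa> a + x * peval \<kappa> p x) 0 (\<kappa> a + y * peval \<kappa> p y)"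
      by (simp add: plus_tri_def times_tri_def)
    finally show ?case by (simp only: peval_pCons)
  qed (simp add: peval_zero tri.peval_zero zero_tri_def)
qed
text \<open>Taylor expansion to first order.\<close>

lemma peval_dual_number:
  fixes \<kappa> :: "'k::field \<Rightarrow> 'c::comm_ring_1"
  assumes "central_scalars \<kappa>"
  shows "peval (tri_scalar \<kappa>) p (Tri x e x) = Tri (peval \<kappa> p x) (e * peval \<kappa> (pderiv p) x) (peval \<kappa> p x)"
proof -
  interpret central_scalars \<kappa> by fact
  interpret tri: central_scalars "tri_scalar \<kappa>" by (rule central_scalars_tri)
  show ?thesis
  proof (induction p)
    case (pCons a p)
    have "peval (tri_scalar \<kappa>) (pCons a p) (Tri x e x) =
        tri_scalar \<kappa> a + Tri x e x * peval (tri_scalar \<kappa>) p (Tri x e x)"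
      by (rule tri.peval_pCons)
    also have "\<dots> = Tri (\<kappa> a) 0 (\<kappa> a) +
        Tri x e x * Tri (peval \<kappa> p x) (e * peval \<kappa> (pderiv p) x) (peval \<kappa> p x)"
      by (simp only: pCons.IH tri_scalar_def)
    also have "\<dots> = Tri (\<kappa> a + x * peval \<kappa> p x)
        (e * (peval \<kappa> p x + (\<kappa> 0 + x * peval \<kappa> (pderiv p) x))) (\<kappa> a + x * peval \<kappa> p x)"
      by (simp add: plus_tri_def times_tri_def scalar_zero algebra_simps)
    finally show ?case by (simp only: peval_pCons pderiv_pCons peval_add)
  qed (simp add: peval_zero tri.peval_zero zero_tri_def)
qed

section \<open>Relations of generalized down-up algebras\<close>

definition udt_eval :: "('k::comm_ring_1 \<Rightarrow> 'c::ring_1) \<Rightarrow> 'c \<Rightarrow> 'c \<Rightarrow> 'c \<Rightarrow> (udt, 'k) free_alg \<Rightarrow> 'c" where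
  "udt_eval \<kappa> U D T = free_eval \<kappa> (case_udt U D T)"

context central_scalars
begin

lemma algebra_hom_udt_eval: "algebra_hom \<kappa> (udt_eval \<kappa> U D T)"
  unfolding udt_eval_def by (rule algebra_hom_free_eval)

lemma udt_eval_gen:
  "udt_eval \<kappa> U D T (gen Gen_u) = U" "udt_eval \<kappa> U D T (gen Gen_d) = D" "udt_eval \<kappa> U D T (gen Gen_t) = T"
  by (simp_all add: udt_eval_def free_eval_gen)

end

lemma udt_hom_cong_ideal:
  fixes h h' :: "(udt, 'k::comm_ring_1) free_alg \<Rightarrow> 'c::ring_1"
  assumes "algebra_hom \<kappa> h" "algebra_hom \<kappa> h'" "two_sided_ideal J"
    and "h (gen Gen_u) - h' (gen Gen_u) \<in> J" "h (gen Gen_d) - h' (gen Gen_d) \<in> J"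
      "h (gen Gen_t) - h' (gen Gen_t) \<in> J"
  shows "h x - h' x \<in> J"
proof (rule algebra_hom_cong_ideal[OF assms(1-3)])
  show "h (gen g) - h' (gen g) \<in> J" for g using assms(4-6) by (cases g) auto
qed

lemma udt_hom_ext:
  fixes h h' :: "(udt, 'k::comm_ring_1) free_alg \<Rightarrow> 'c::ring_1"
  assumes "algebra_hom \<kappa> h" "algebra_hom \<kappa> h'"
    and "h (gen Gen_u) = h' (gen Gen_u)" "h (gen Gen_d) = h' (gen Gen_d)" "h (gen Gen_t) = h' (gen Gen_t)"
  shows "h x = h' x"
proof (rule algebra_hom_ext[OF assms(1,2)])
  show "h (gen g) = h' (gen g)" for g using assms(3-5) by (cases g) auto
qed

text \<open>
  The four relators, evaluated in an arbitrary algebra. A homomorphism kills the relations modulo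
  an ideal iff the ideal contains the relator values of the images of \<open>u\<close>, \<open>d\<close> and \<open>t\<close>.
\<close>

definition relator_values ::
    "('k::comm_ring_1 \<Rightarrow> 'c::ring_1) \<Rightarrow> 'k \<Rightarrow> 'k \<Rightarrow> 'k poly \<Rightarrow> 'c \<Rightarrow> 'c \<Rightarrow> 'c \<Rightarrow> 'c set" where
  "relator_values \<kappa> r s \<phi> U D T =
    {T * U - U * T, T * D - D * T,
     D * D * U - \<kappa> (r + s) * D * U * D + \<kappa> (r * s) * U * D * D - peval \<kappa> \<phi> T * D,
     D * U * U - \<kappa> (r + s) * U * D * U + \<kappa> (r * s) * U * U * D - peval \<kappa> \<phi> T * U}"

lemma down_up_relators_eq:
  "down_up_relators r s \<phi> = relator_values const r s \<phi> (gen Gen_u) (gen Gen_d) (gen Gen_t)"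
  by (simp add: down_up_relators_def relator_values_def poly_at_eq_peval Let_def power2_eq_square mult.assoc)

lemma (in algebra_hom) hom_relator_values:
  "h ` relator_values const r s \<phi> U D T = relator_values \<kappa> r s \<phi> (h U) (h D) (h T)"
  by (simp add: relator_values_def hom_diff hom_add hom_mult hom_const hom_peval)

lemma down_up_algebra_isomorphic_iff:
  "down_up_algebra r s \<phi> \<cong>\<^sub>a\<^sub>l\<^sub>g down_up_algebra r' s' \<phi>' \<longleftrightarrow>
    (\<exists>F G. inverse_substitutions (down_up_relators r s \<phi>) (down_up_relators r' s' \<phi>') F G)"
  by (simp add: down_up_algebra_def presented_algebra_isomorphic_iff)

lemma down_up_isomorphic_trans:
  "down_up_algebra r s \<phi> \<cong>\<^sub>a\<^sub>l\<^sub>g down_up_algebra r' s' \<phi>' \<Longrightarrow>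
   down_up_algebra r' s' \<phi>' \<cong>\<^sub>a\<^sub>l\<^sub>g down_up_algebra r'' s'' \<phi>'' \<Longrightarrow>
   down_up_algebra r s \<phi> \<cong>\<^sub>a\<^sub>l\<^sub>g down_up_algebra r'' s'' \<phi>''"
  unfolding down_up_algebra_isomorphic_iff by (elim exE, intro exI) (rule inverse_substitutions_trans)

lemma down_up_algebra_commute: "down_up_algebra r s \<phi> = down_up_algebra s r \<phi>"
  by (simp add: down_up_algebra_def down_up_relators_def add.commute mult.commute)

section \<open>Affine substitutions and the exchange of \<open>u\<close> and \<open>d\<close>\<close>

interpretation const: central_scalars "const :: 'k::comm_ring_1 \<Rightarrow> ('g, 'k) free_alg"
  by (rule central_scalars_const)

text \<open>
  Rewrite rules that collect all scalars of a monomial at its left end. The centrality of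
  scalars alone would loop as a rewrite rule on products of scalars.
\<close>

lemma const_mult_normalize:
  fixes x y :: "('a, 'b::comm_ring_1) free_alg"
  shows
  "gen g * const c = const c * gen g" "gen g * (const c * y) = const c * (gen g * y)"
  "peval const p x * const c = const c * peval const p x"
  "peval const p x * (const c * y) = const c * (peval const p x * y)"
  "const a * const b = const (a * b)" "const a * (const b * y) = const (a * b) * y"
proof -
  have comm: "x * (const c * y) = const c * (x * y)" for x y :: "('a, 'b) free_alg" and c
    by (simp only: mult.assoc[symmetric] const.scalar_commute[of c x])
  show "gen g * (const c * y) = const c * (gen g * y)"
    "peval const p x * (const c * y) = const c * (peval const p x * y)"
    by (rule comm)+
  show "gen g * const c = const c * gen g" "peval const p x * const c = const c * peval const p x"
    by (rule const.scalar_commute[symmetric])+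
  show "const a * const b = const (a * b)" "const a * (const b * y) = const (a * b) * y"
    by (simp_all only: const.scalar_mult mult.assoc)
qed

text \<open>
  Every relator becomes a scalar multiple of the corresponding one: \<open>\<eta>\<close> enters the cubic terms
  through \<open>u\<close> and the term with \<open>\<phi>\<close> through the hypothesis.
\<close>

lemma affine_substitution_relators:
  fixes \<phi> \<psi> :: "'k::field poly"
  assumes "pcompose \<phi> [:b, a:] = Polynomial.smult \<eta> \<psi>"
  shows "udt_eval const (const \<eta> * gen Gen_u) (gen Gen_d) (const b + const a * gen Gen_t) `
      down_up_relators r s \<phi> \<subseteq> relation_ideal (down_up_relators r s \<psi>)"
proof -
  let ?U = "gen Gen_u :: (udt, 'k) free_alg" and ?D = "gen Gen_d :: (udt, 'k) free_alg"
    and ?T = "gen Gen_t :: (udt, 'k) free_alg"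
  let ?F = "udt_eval const (const \<eta> * ?U) ?D (const b + const a * ?T)"
  interpret F: algebra_hom const ?F by (rule const.algebra_hom_udt_eval)
  have T: "peval const \<phi> (const b + const a * ?T) = const \<eta> * peval const \<psi> ?T"
  proof -
    have "const b + const a * ?T = peval const [:b, a:] ?T"
      by (simp add: const.peval_pCons const.peval_zero const_mult_normalize)
    then show ?thesis by (simp add: const.peval_pcompose[symmetric] assms const.peval_smult)
  qed
  have "?F ` down_up_relators r s \<phi> = relator_values const r s \<phi> (const \<eta> * ?U) ?D (const b + const a * ?T)"
    by (simp add: down_up_relators_eq F.hom_relator_values const.udt_eval_gen)
  also have "\<dots> \<subseteq> {const c * x |c x. x \<in> relator_values const r s \<psi> ?U ?D ?T}"
  proof -
    have "(const b + const a * ?T) * (const \<eta> * ?U) - const \<eta> * ?U * (const b + const a * ?T) =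
        const (a * \<eta>) * (?T * ?U - ?U * ?T)"
      by (simp add: const_mult_normalize algebra_simps)
    moreover have "(const b + const a * ?T) * ?D - ?D * (const b + const a * ?T) = const a * (?T * ?D - ?D * ?T)"
      by (simp add: const_mult_normalize algebra_simps)
    moreover have "?D * ?D * (const \<eta> * ?U) - const (r + s) * ?D * (const \<eta> * ?U) * ?D +
        const (r * s) * (const \<eta> * ?U) * ?D * ?D - peval const \<phi> (const b + const a * ?T) * ?D =
        const \<eta> * (?D * ?D * ?U - const (r + s) * ?D * ?U * ?D + const (r * s) * ?U * ?D * ?D -
          peval const \<psi> ?T * ?D)"
      unfolding T by (simp add: const_mult_normalize mult.assoc right_diff_distrib distrib_left mult.commute mult.left_commute distrib_right)
    moreover have "?D * (const \<eta> * ?U) * (const \<eta> * ?U) - const (r + s) * (const \<eta> * ?U) * ?D * (const \<eta> * ?U) +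
        const (r * s) * (const \<eta> * ?U) * (const \<eta> * ?U) * ?D -
        peval const \<phi> (const b + const a * ?T) * (const \<eta> * ?U) =
        const (\<eta> * \<eta>) * (?D * ?U * ?U - const (r + s) * ?U * ?D * ?U + const (r * s) * ?U * ?U * ?D -
          peval const \<psi> ?T * ?U)"
      unfolding T by (simp add: const_mult_normalize mult.assoc right_diff_distrib distrib_left distrib_right
          mult.commute mult.left_commute)
    ultimately show ?thesis unfolding relator_values_def by blast
  qed
  also have "\<dots> \<subseteq> relation_ideal (down_up_relators r s \<psi>)"
    using relation_ideal_superset[of "down_up_relators r s \<psi>"]
    by (auto simp: down_up_relators_eq intro!: two_sided_ideal_mult_left[OF two_sided_ideal_relation_ideal])
  finally show ?thesis .
qed

lemma pcompose_affine_inverse: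
  assumes "pcompose \<phi> [:b, a:] = Polynomial.smult \<eta> \<psi>" "a \<noteq> 0" "\<eta> \<noteq> 0"
  shows "pcompose \<psi> [:- b / a, 1 / a:] = Polynomial.smult (1 / \<eta>) (\<phi> :: 'k::field poly)"
proof -
  have "\<phi> = pcompose \<phi> (pcompose [:b, a:] [:- b / a, 1 / a:])"
    using assms(2) by (simp add: pcompose_pCons)
  also have "\<dots> = Polynomial.smult \<eta> (pcompose \<psi> [:- b / a, 1 / a:])"
    by (simp add: pcompose_assoc assms(1) pcompose_smult)
  finally show ?thesis using assms(3) by simp
qed

lemma affine_equiv_imp_isomorphic:
  fixes \<phi> \<psi> :: "'k::field poly"
  assumes "affine_equiv \<phi> \<psi>"
  shows "down_up_algebra r s \<phi> \<cong>\<^sub>a\<^sub>l\<^sub>g down_up_algebra r s \<psi>"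
proof -
  obtain \<eta> a b where nz: "\<eta> \<noteq> 0" "a \<noteq> 0" and eq: "pcompose \<phi> [:b, a:] = Polynomial.smult \<eta> \<psi>"
    using assms by (auto simp: affine_equiv_def)
  define F where "F = udt_eval const (const \<eta> * gen Gen_u) (gen Gen_d) (const b + const a * gen Gen_t :: (udt, 'k) free_alg)"
  define G where "G = udt_eval const (const (1 / \<eta>) * gen Gen_u) (gen Gen_d)
    (const (- b / a) + const (1 / a) * gen Gen_t :: (udt, 'k) free_alg)"
  interpret F: algebra_hom const F unfolding F_def by (rule const.algebra_hom_udt_eval)
  interpret G: algebra_hom const G unfolding G_def by (rule const.algebra_hom_udt_eval)
  note gens = const.udt_eval_gen[of "const \<eta> * gen Gen_u" "gen Gen_d" "const b + const a * gen Gen_t :: (udt, 'k) free_alg", folded F_def]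
    const.udt_eval_gen[of "const (1 / \<eta>) * gen Gen_u" "gen Gen_d" "const (- b / a) + const (1 / a) * gen Gen_t :: (udt, 'k) free_alg", folded G_def]
  have "inverse_substitutions (down_up_relators r s \<phi>) (down_up_relators r s \<psi>) F G"
  proof (rule inverse_substitutionsI[OF F.algebra_hom_axioms G.algebra_hom_axioms])
    show "F ` down_up_relators r s \<phi> \<subseteq> relation_ideal (down_up_relators r s \<psi>)"
      unfolding F_def by (rule affine_substitution_relators[OF eq])
    show "G ` down_up_relators r s \<psi> \<subseteq> relation_ideal (down_up_relators r s \<phi>)"
      unfolding G_def by (rule affine_substitution_relators[OF pcompose_affine_inverse[OF eq nz(2,1)]])
    have "G (F (gen Gen_u)) = const (\<eta> * (1 / \<eta>)) * gen Gen_u"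
      by (simp only: gens G.hom_mult G.hom_const const_mult_normalize)
    moreover have "G (F (gen Gen_t)) = const (b + a * (- b / a)) + const (a * (1 / a)) * gen Gen_t"
      by (simp only: gens G.hom_add G.hom_mult G.hom_const const_mult_normalize distrib_left
        const.scalar_add add.assoc)
    moreover have "G (F (gen Gen_d)) = gen Gen_d" by (simp only: gens)
    ultimately show "G (F (gen g)) = gen g" for g
      using nz by (cases g) (simp_all add: const.scalar_one const.scalar_zero)
    have "F (G (gen Gen_u)) = const (1 / \<eta> * \<eta>) * gen Gen_u"
      by (simp only: gens F.hom_mult F.hom_const const_mult_normalize)
    moreover have "F (G (gen Gen_t)) = const (- b / a + 1 / a * b) + const (1 / a * a) * gen Gen_t"
      by (simp only: gens F.hom_add F.hom_mult F.hom_const const_mult_normalize distrib_left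
        const.scalar_add add.assoc)
    moreover have "F (G (gen Gen_d)) = gen Gen_d" by (simp only: gens)
    ultimately show "F (G (gen g)) = gen g" for g
      using nz by (cases g) (simp_all add: const.scalar_one const.scalar_zero)
  qed
  then show ?thesis unfolding down_up_algebra_isomorphic_iff by blast
qed

text \<open>
  The exchange reverses the order of the three cubic terms, whose coefficients are
  \<open>1, - (r + s), r s\<close>. Division by \<open>r s\<close> turns them into those for the inverse parameters.
\<close>

lemma exchange_substitution_relators:
  fixes \<phi> :: "'k::field poly"
  assumes "r \<noteq> 0" "s \<noteq> 0"
  shows "udt_eval const (gen Gen_d) (gen Gen_u) (gen Gen_t) ` down_up_relators r s \<phi> \<subseteq>
      relation_ideal (down_up_relators (1 / r) (1 / s) (Polynomial.smult (1 / (r * s)) \<phi>))"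
proof -
  let ?U = "gen Gen_u :: (udt, 'k) free_alg" and ?D = "gen Gen_d :: (udt, 'k) free_alg"
    and ?T = "gen Gen_t :: (udt, 'k) free_alg"
  let ?F = "udt_eval const ?D ?U ?T" and ?\<psi> = "Polynomial.smult (1 / (r * s)) \<phi>"
  interpret F: algebra_hom const ?F by (rule const.algebra_hom_udt_eval)
  have one: "const 1 * x = x" for x :: "(udt, 'k) free_alg"
    by (simp add: const.scalar_one)
  have "?F ` down_up_relators r s \<phi> = relator_values const r s \<phi> ?D ?U ?T"
    by (simp add: down_up_relators_eq F.hom_relator_values const.udt_eval_gen)
  also have "\<dots> \<subseteq> {const c * x |c x. x \<in> relator_values const (1 / r) (1 / s) ?\<psi> ?U ?D ?T}"
  proof -
    have "?T * ?D - ?D * ?T = const 1 * (?T * ?D - ?D * ?T)" "?T * ?U - ?U * ?T = const 1 * (?T * ?U - ?U * ?T)"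
      by (simp_all add: const.scalar_one)
    moreover have "?U * ?U * ?D - const (r + s) * ?U * ?D * ?U + const (r * s) * ?D * ?U * ?U - peval const \<phi> ?T * ?U =
        const (r * s) * (?D * ?U * ?U - const (1 / r + 1 / s) * ?U * ?D * ?U + const (1 / r * (1 / s)) * ?U * ?U * ?D -
          peval const ?\<psi> ?T * ?U)"
      using assms by (simp add: const_mult_normalize const.peval_smult mult.assoc right_diff_distrib distrib_left one)
        (simp add: distrib_left field_simps)
    moreover have "?U * ?D * ?D - const (r + s) * ?D * ?U * ?D + const (r * s) * ?D * ?D * ?U - peval const \<phi> ?T * ?D =
        const (r * s) * (?D * ?D * ?U - const (1 / r + 1 / s) * ?D * ?U * ?D + const (1 / r * (1 / s)) * ?U * ?D * ?D -
          peval const ?\<psi> ?T * ?D)"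
      using assms by (simp add: const_mult_normalize const.peval_smult mult.assoc right_diff_distrib distrib_left one)
        (simp add: distrib_left field_simps)
    ultimately show ?thesis unfolding relator_values_def by blast
  qed
  also have "\<dots> \<subseteq> relation_ideal (down_up_relators (1 / r) (1 / s) ?\<psi>)"
    using relation_ideal_superset[of "down_up_relators (1 / r) (1 / s) ?\<psi>"]
    by (auto simp: down_up_relators_eq intro!: two_sided_ideal_mult_left[OF two_sided_ideal_relation_ideal])
  finally show ?thesis .
qed

lemma exchange_isomorphic:
  fixes \<phi> :: "'k::field poly"
  assumes nz: "r \<noteq> 0" "s \<noteq> 0"
  shows "down_up_algebra r s \<phi> \<cong>\<^sub>a\<^sub>l\<^sub>g
    down_up_algebra (1 / r) (1 / s) (Polynomial.smult (1 / (r * s)) \<phi>)"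
proof -
  let ?\<psi> = "Polynomial.smult (1 / (r * s)) \<phi>"
  define F :: "(udt, 'k) free_alg \<Rightarrow> (udt, 'k) free_alg"
    where "F = udt_eval const (gen Gen_d) (gen Gen_u) (gen Gen_t)"
  have F: "algebra_hom const F" unfolding F_def by (rule const.algebra_hom_udt_eval)
  have "inverse_substitutions (down_up_relators r s \<phi>) (down_up_relators (1 / r) (1 / s) ?\<psi>) F F"
  proof (rule inverse_substitutionsI[OF F F])
    show "F ` down_up_relators r s \<phi> \<subseteq> relation_ideal (down_up_relators (1 / r) (1 / s) ?\<psi>)"
      unfolding F_def by (rule exchange_substitution_relators[OF nz])
    show "F ` down_up_relators (1 / r) (1 / s) ?\<psi> \<subseteq> relation_ideal (down_up_relators r s \<phi>)"
    proof -
      have "Polynomial.smult (1 / (1 / r * (1 / s))) ?\<psi> = \<phi>" "1 / (1 / r) = r" "1 / (1 / s) = s"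
        using nz by simp_all
      with exchange_substitution_relators[of "1 / r" "1 / s" ?\<psi>] nz show ?thesis
        by (simp only: F_def) auto
    qed
    have gens: "F (gen Gen_u) = gen Gen_d" "F (gen Gen_d) = gen Gen_u" "F (gen Gen_t) = gen Gen_t"
      unfolding F_def by (rule const.udt_eval_gen)+
    show "F (F (gen g)) = gen g" for g
      by (cases g) (simp_all add: gens)
    then show "F (F (gen g)) = gen g" for g .
  qed
  then show ?thesis unfolding down_up_algebra_isomorphic_iff by blast
qed

section \<open>Commutative points and their tangent vectors\<close>

abbreviation relations :: "'k::comm_ring_1 \<Rightarrow> 'k \<Rightarrow> 'k poly \<Rightarrow> (udt, 'k) free_alg set" where
  "relations r s \<phi> \<equiv> relation_ideal (down_up_relators r s \<phi>)"

lemma hom_relations: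
  fixes h :: "(udt, 'k::comm_ring_1) free_alg \<Rightarrow> 'c::ring_1"
  assumes h: "algebra_hom \<kappa> h" and "two_sided_ideal J"
    and "relator_values \<kappa> r s \<phi> (h (gen Gen_u)) (h (gen Gen_d)) (h (gen Gen_t)) \<subseteq> J"
    and "x \<in> relations r s \<phi>"
  shows "h x \<in> J"
  by (rule algebra_hom.hom_relation_ideal[OF assms(1,2) _ assms(4)])
    (use assms(3) in \<open>simp add: down_up_relators_eq algebra_hom.hom_relator_values[OF h]\<close>)

lemma relator_values_subset:
  fixes h :: "(udt, 'k::comm_ring_1) free_alg \<Rightarrow> 'c::ring_1"
  assumes h: "algebra_hom \<kappa> h" and "\<And>x. x \<in> relations r s \<phi> \<Longrightarrow> h x \<in> J"
  shows "relator_values \<kappa> r s \<phi> (h (gen Gen_u)) (h (gen Gen_d)) (h (gen Gen_t)) \<subseteq> J"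
proof -
  have "h ` down_up_relators r s \<phi> \<subseteq> J"
    using assms(2) relation_ideal_superset by blast
  then show ?thesis by (simp add: down_up_relators_eq algebra_hom.hom_relator_values[OF h])
qed

lemma relator_values_commutative:
  fixes \<kappa> :: "'k::field \<Rightarrow> 'c::comm_ring_1"
  assumes "central_scalars \<kappa>"
  shows "relator_values \<kappa> r s \<phi> U D T =
    {0, (\<kappa> ((1 - r) * (1 - s)) * U * D - peval \<kappa> \<phi> T) * D, (\<kappa> ((1 - r) * (1 - s)) * U * D - peval \<kappa> \<phi> T) * U}"
proof -
  interpret central_scalars \<kappa> by fact
  have \<gamma>: "\<kappa> ((1 - r) * (1 - s)) = 1 - \<kappa> (r + s) + \<kappa> (r * s)"
    by (simp add: scalar_diff scalar_add scalar_mult scalar_one algebra_simps)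
  show ?thesis
    unfolding relator_values_def \<gamma> by (simp add: algebra_simps)
qed

text \<open>
  \<open>E = 0\<close> is the equation of the surface of characters and \<open>E'\<close> is the derivative of \<open>E\<close> in the
  direction \<open>(a, b, e)\<close>.
\<close>

lemma relator_values_dual_numbers:
  fixes \<kappa> :: "'k::field \<Rightarrow> 'c::comm_ring_1" and r s :: 'k and \<phi> :: "'k poly" and U D T a b e :: 'c
  assumes "central_scalars \<kappa>"
  defines "E \<equiv> \<kappa> ((1 - r) * (1 - s)) * U * D - peval \<kappa> \<phi> T"
    and "E' \<equiv> \<kappa> ((1 - r) * (1 - s)) * (a * D + U * b) - e * peval \<kappa> (pderiv \<phi>) T"
  shows "relator_values (tri_scalar \<kappa>) r s \<phi> (Tri U a U) (Tri D b D) (Tri T e T) =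
    {0, Tri (E * D) (E * b + E' * D) (E * D), Tri (E * U) (E * a + E' * U) (E * U)}"
proof -
  interpret central_scalars \<kappa> by fact
  have \<gamma>: "\<kappa> ((1 - r) * (1 - s)) = 1 - \<kappa> (r + s) + \<kappa> (r * s)"
    by (simp add: scalar_diff scalar_add scalar_mult scalar_one algebra_simps)
  show ?thesis
    unfolding relator_values_def peval_dual_number[OF assms(1)] E_def E'_def \<gamma> tri_scalar_def
    by (simp add: tri_simps algebra_simps)
qed

interpretation pconst: central_scalars "\<lambda>c::'k::comm_ring_1. [:c:]"
  by standard simp_all

lemma peval_pconst: "peval (\<lambda>c. [:c:]) p q = pcompose p q"
  by (induction p) (simp_all add: pconst.peval_zero pconst.peval_pCons pcompose_pCons)

text \<open>The line \<open>u = d = 0\<close> of characters, on which \<open>t\<close> is free.\<close>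

definition line :: "(udt, 'k::field) free_alg \<Rightarrow> 'k poly" where
  "line = udt_eval (\<lambda>c. [:c:]) 0 0 [:0, 1:]"

interpretation line: algebra_hom "\<lambda>c. [:c:]" line
  unfolding line_def by (rule pconst.algebra_hom_udt_eval)

lemma line_gen: "line (gen Gen_u) = 0" "line (gen Gen_d) = 0" "line (gen Gen_t) = [:0, 1:]"
  by (simp_all only: line_def pconst.udt_eval_gen)

lemma line_relations: "x \<in> relations r s \<phi> \<Longrightarrow> line x = 0"
  using hom_relations[OF line.algebra_hom_axioms two_sided_ideal_singleton_zero, of r s \<phi> x]
  by (simp add: line_gen relator_values_commutative pconst.central_scalars_axioms)

lemma line_eq_of_diff: "x - y \<in> relations r s \<phi> \<Longrightarrow> line x = line y"
  using line_relations[of "x - y"] by (simp add: line.hom_diff)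

text \<open>
  A tangent vector along the image of the line is carried back by \<open>G\<close> to a tangent vector along
  the line itself. There the derivative of the relators is \<open>- \<phi>'\<close> times its components in the
  directions of \<open>u\<close> and \<open>d\<close>, so for \<open>\<phi>' \<noteq> 0\<close> the vector points along the line and is a multiple
  \<open>c\<close> of the derivative by \<open>t\<close>, whose image under \<open>F\<close> consists of the derivatives of \<open>U\<close>, \<open>D\<close>
  and \<open>T\<close>.
\<close>

lemma tangent_line_rank_one:
  fixes \<phi> \<phi>' :: "'k::field poly"
  assumes FG: "inverse_substitutions (down_up_relators r s \<phi>) (down_up_relators r' s' \<phi>') F G"
    and "\<phi>' \<noteq> 0"
  defines "U \<equiv> line (F (gen Gen_u))" and "D \<equiv> line (F (gen Gen_d))" and "T \<equiv> line (F (gen Gen_t))"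
  assumes kills: "relator_values (tri_scalar (\<lambda>c. [:c:])) r s \<phi> (Tri U a U) (Tri D b D) (Tri T e T) \<subseteq> {0}"
  shows "\<exists>c. a = c * pderiv U \<and> b = c * pderiv D \<and> e = c * pderiv T"
proof -
  let ?\<kappa> = "\<lambda>c::'k. [:c:]"
  interpret tri: central_scalars "tri_scalar ?\<kappa>" by (rule pconst.central_scalars_tri)
  have F: "algebra_hom const F" and G: "algebra_hom const G"
    and FGy: "F (G y) - y \<in> relations r' s' \<phi>'" and GFx: "G (F x) - x \<in> relations r s \<phi>" for x y
    using FG by (auto simp: inverse_substitutions_def)
  define \<Delta> where "\<Delta> = udt_eval (tri_scalar ?\<kappa>) (Tri U a U) (Tri D b D) (Tri T e T)"
  interpret \<Delta>: algebra_hom "tri_scalar ?\<kappa>" \<Delta>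
    unfolding \<Delta>_def by (rule tri.algebra_hom_udt_eval)
  have \<Delta>_gen: "\<Delta> (gen Gen_u) = Tri U a U" "\<Delta> (gen Gen_d) = Tri D b D" "\<Delta> (gen Gen_t) = Tri T e T"
    unfolding \<Delta>_def by (rule tri.udt_eval_gen)+
  have \<Delta>_zero: "\<Delta> x = 0" if "x \<in> relations r s \<phi>" for x
    using hom_relations[OF \<Delta>.algebra_hom_axioms two_sided_ideal_singleton_zero _ that] kills by (simp add: \<Delta>_gen)
  interpret lineF: algebra_hom ?\<kappa> "\<lambda>x. line (F x)"
    by (rule algebra_hom_compose[OF F line.algebra_hom_axioms])
  have diag: "ul (\<Delta> x) = line (F x)" "lr (\<Delta> x) = line (F x)" for x
    by (rule udt_hom_ext[OF pconst.algebra_hom_ul_lr(1)[OF \<Delta>.algebra_hom_axioms] lineF.algebra_hom_axioms]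
        udt_hom_ext[OF pconst.algebra_hom_ul_lr(2)[OF \<Delta>.algebra_hom_axioms] lineF.algebra_hom_axioms];
        simp add: \<Delta>_gen U_def D_def T_def)+
  define \<Theta> where "\<Theta> y = \<Delta> (G y)" for y
  interpret \<Theta>: algebra_hom "tri_scalar ?\<kappa>" \<Theta>
    unfolding \<Theta>_def by (rule algebra_hom_compose[OF G \<Delta>.algebra_hom_axioms])
  have \<Theta>_diag: "ul (\<Theta> y) = line y" "lr (\<Theta> y) = line y" for y
    using line_eq_of_diff[OF FGy] by (simp_all add: \<Theta>_def diag)
  define a' b' c where "a' = ur (\<Theta> (gen Gen_u))" and "b' = ur (\<Theta> (gen Gen_d))" and "c = ur (\<Theta> (gen Gen_t))"
  have \<Theta>_gen: "\<Theta> (gen Gen_u) = Tri 0 a' 0" "\<Theta> (gen Gen_d) = Tri 0 b' 0"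
      "\<Theta> (gen Gen_t) = Tri [:0, 1:] c [:0, 1:]"
    by (simp_all add: tri.expand \<Theta>_diag line_gen a'_def b'_def c_def)
  have "\<Theta> y = 0" if "y \<in> relations r' s' \<phi>'" for y
    unfolding \<Theta>_def by (rule \<Delta>_zero, rule inverse_substitutions_relation_ideal[OF inverse_substitutions_sym[OF FG] that])
  then have "relator_values (tri_scalar ?\<kappa>) r' s' \<phi>' (Tri 0 a' 0) (Tri 0 b' 0) (Tri [:0, 1:] c [:0, 1:]) \<subseteq> {0}"
    using relator_values_subset[OF \<Theta>.algebra_hom_axioms, of r' s' \<phi>' "{0}"] by (simp add: \<Theta>_gen)
  then have "\<phi>' * a' = 0" "\<phi>' * b' = 0"
    by (simp_all add: relator_values_dual_numbers pconst.central_scalars_axioms peval_pconst zero_tri_def)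
  then have ab': "a' = 0" "b' = 0" using \<open>\<phi>' \<noteq> 0\<close> by simp_all
  have der: "algebra_hom (tri_scalar ?\<kappa>) (\<lambda>y. Tri (line y) (c * pderiv (line y)) (line y))"
    by (rule algebra_hom_triI[OF line.algebra_hom_axioms line.algebra_hom_axioms])
      (simp_all add: line.hom_const line.hom_add line.hom_mult pderiv_pCons pderiv_add pderiv_mult algebra_simps)
  have "\<Theta> y = Tri (line y) (c * pderiv (line y)) (line y)" for y
    by (rule udt_hom_ext[OF \<Theta>.algebra_hom_axioms der])
      (simp_all add: \<Theta>_gen ab' line_gen pderiv_pCons)
  moreover have "\<Theta> (F x) = \<Delta> x" for x
    using \<Delta>_zero[OF GFx[of x]] by (simp add: \<Theta>_def \<Delta>.hom_diff)
  ultimately have "\<Delta> x = Tri (line (F x)) (c * pderiv (line (F x))) (line (F x))" for x by metis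
  from this[of "gen Gen_u"] this[of "gen Gen_d"] this[of "gen Gen_t"] show ?thesis
    by (auto simp: \<Delta>_gen U_def D_def T_def)
qed

text \<open>
  If \<open>U\<close> or \<open>D\<close> were nonzero, the image of the line would lie on the surface \<open>E = 0\<close>. On it,
  \<open>(U, - D, 0)\<close>, \<open>(\<partial>\<phi>(T), 0, \<gamma> D)\<close> and \<open>(0, \<partial>\<phi>(T), \<gamma> U)\<close>, with \<open>\<partial>\<phi>\<close> the derivative of
  \<open>\<phi>\<close> and \<open>\<gamma> = (1 - r) (1 - s)\<close>, are tangent vectors, and these are too independent for the
  rank one property. If \<open>\<phi>\<close> were zero, \<open>(1, 0, 0)\<close> would be tangent to the line.
\<close>

lemma line_preserved:
  fixes \<phi> \<phi>' :: "'k::field poly"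
  assumes FG: "inverse_substitutions (down_up_relators r s \<phi>) (down_up_relators r' s' \<phi>') F G"
    and "\<phi>' \<noteq> 0" "r \<noteq> 1" "s \<noteq> 1"
  shows "line (F (gen Gen_u)) = 0" and "line (F (gen Gen_d)) = 0" and "\<phi> \<noteq> 0"
proof -
  define \<gamma> where "\<gamma> = (1 - r) * (1 - s)"
  have \<gamma>: "\<gamma> \<noteq> 0" using assms by (simp add: \<gamma>_def)
  define U D T where "U = line (F (gen Gen_u))" and "D = line (F (gen Gen_d))" and "T = line (F (gen Gen_t))"
  define E where "E = [:\<gamma>:] * U * D - pcompose \<phi> T"
  have F: "algebra_hom const F" using FG by (simp add: inverse_substitutions_def)
  interpret lineF: algebra_hom "\<lambda>c. [:c:]" "\<lambda>x. line (F x)"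
    by (rule algebra_hom_compose[OF F line.algebra_hom_axioms])
  have "line (F x) \<in> {0}" if "x \<in> relations r s \<phi>" for x
    using line_relations[OF inverse_substitutions_relation_ideal[OF FG that]] by simp
  from relator_values_subset[OF lineF.algebra_hom_axioms this]
  have ED: "E * D = 0" and EU: "E * U = 0"
    by (simp_all add: relator_values_commutative pconst.central_scalars_axioms peval_pconst E_def U_def D_def T_def \<gamma>_def)
  have tangent: "\<exists>c. a = c * pderiv U \<and> b = c * pderiv D \<and> e = c * pderiv T"
    if "E * b + ([:\<gamma>:] * (a * D + U * b) - e * pcompose (pderiv \<phi>) T) * D = 0"
      and "E * a + ([:\<gamma>:] * (a * D + U * b) - e * pcompose (pderiv \<phi>) T) * U = 0" for a b e
  proof -
    have "relator_values (tri_scalar (\<lambda>c. [:c:])) r s \<phi> (Tri U a U) (Tri D b D) (Tri T e T) \<subseteq> {0}"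
      using that ED EU unfolding E_def \<gamma>_def
      by (simp add: relator_values_dual_numbers pconst.central_scalars_axioms peval_pconst zero_tri_def del: mult_pCons_left)
    from tangent_line_rank_one[OF FG \<open>\<phi>' \<noteq> 0\<close> this[unfolded U_def D_def T_def]]
    show ?thesis unfolding U_def D_def T_def .
  qed
  have "U = 0 \<and> D = 0"
  proof (rule ccontr)
    assume "\<not> ?thesis"
    then have E: "E = 0" using ED EU by auto
    obtain c where c: "U = c * pderiv U" "- D = c * pderiv D" "0 = c * pderiv T"
      using tangent[where a = U and b = "- D" and e = 0] by (auto simp: E)
    obtain c' where c': "[:\<gamma>:] * D = c' * pderiv T"
      using tangent[where a = "pcompose (pderiv \<phi>) T" and b = 0 and e = "[:\<gamma>:] * D"]
      by (auto simp: E algebra_simps simp del: mult_pCons_left mult_pCons_right)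
    obtain c'' where c'': "[:\<gamma>:] * U = c'' * pderiv T"
      using tangent[where a = 0 and b = "pcompose (pderiv \<phi>) T" and e = "[:\<gamma>:] * U"]
      by (auto simp: E algebra_simps simp del: mult_pCons_left mult_pCons_right)
    have "c = 0 \<or> pderiv T = 0" using c(3) by simp
    then have "U = 0 \<and> D = 0" using c(1,2) c' c'' \<gamma> by auto
    with \<open>\<not> ?thesis\<close> show False by simp
  qed
  then show UD: "line (F (gen Gen_u)) = 0" "line (F (gen Gen_d)) = 0" by (simp_all add: U_def D_def)
  show "\<phi> \<noteq> 0"
  proof
    assume "\<phi> = 0"
    with UD have "E = 0" by (simp add: E_def U_def)
    then obtain c where "1 = c * pderiv U"
      using tangent[where a = 1 and b = 0 and e = 0] UD by (auto simp: U_def D_def)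
    then show False using UD by (simp add: U_def)
  qed
qed

text \<open>On coordinate rings of the lines, a substitution that preserves them is a composition.\<close>

lemma line_substitution:
  fixes \<phi> \<phi>' :: "'k::field poly"
  assumes "algebra_hom const F"
    and "line (F (gen Gen_u)) = 0" "line (F (gen Gen_d)) = 0"
  shows "line (F x) = pcompose (line x) (line (F (gen Gen_t)))"
proof (rule udt_hom_ext[where h = "\<lambda>x. line (F x)"])
  show "algebra_hom (\<lambda>c. [:c:]) (\<lambda>x. line (F x))"
    by (rule algebra_hom_compose[OF assms(1) line.algebra_hom_axioms])
  show "algebra_hom (\<lambda>c. [:c:]) (\<lambda>x. pcompose (line x) (line (F (gen Gen_t))))"
    by unfold_locales (simp_all add: line.hom_const line.hom_add line.hom_mult pcompose_add pcompose_mult)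
qed (simp_all add: assms line_gen pcompose_pCons)

text \<open>
  The homomorphism \<open>u \<mapsto> \<epsilon>, d \<mapsto> 0, t \<mapsto> t\<close> to the dual numbers \<open>K[t][\<epsilon>]\<close> kills the relations
  modulo \<open>\<phi>' \<epsilon>\<close>: it is a conormal direction with annihilator \<open>\<phi>'\<close>. Composed with \<open>F\<close> it gives a
  direction at the first line, all of whose components normal to the line are killed
  by \<open>\<phi>(h)\<close>, where \<open>h\<close> is the image of \<open>t\<close>. As the element \<open>u\<close> is recovered from its
  image under \<open>G\<close>, the polynomial \<open>\<phi>(h)\<close> kills the component \<open>1\<close> modulo \<open>\<phi>'\<close>.
\<close>

lemma conormal_dvd:
  fixes \<phi> \<phi>' :: "'k::field poly"
  assumes FG: "inverse_substitutions (down_up_relators r s \<phi>) (down_up_relators r' s' \<phi>') F G"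
    and F0: "line (F (gen Gen_u)) = 0" "line (F (gen Gen_d)) = 0"
    and G0: "line (G (gen Gen_u)) = 0"
  shows "\<phi>' dvd pcompose \<phi> (line (F (gen Gen_t)))"
proof -
  let ?\<kappa> = "\<lambda>c::'k. [:c:]"
  define h where "h = line (F (gen Gen_t))"
  interpret tri: central_scalars "tri_scalar ?\<kappa>" by (rule pconst.central_scalars_tri)
  have F: "algebra_hom const F"
    and FGy: "F (G y) - y \<in> relations r' s' \<phi>'" for y
    using FG by (auto simp: inverse_substitutions_def)
  have J: "two_sided_ideal {Tri 0 y 0 |y. q dvd p * y}" for p q :: "'k poly"
  proof -
    have "q dvd p * (c * y)" "q dvd p * (y * c)" if "q dvd p * y" for c y
      using dvd_mult[OF that, of c] by (simp_all add: ac_simps)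
    then show ?thesis
      by (intro two_sided_idealI) (auto simp: tri_simps distrib_left intro: dvd_add)
  qed
  define \<Delta> where "\<Delta> = udt_eval (tri_scalar ?\<kappa>) (Tri 0 1 0) (Tri 0 0 0) (Tri [:0, 1:] 0 [:0, 1:])"
  interpret \<Delta>: algebra_hom "tri_scalar ?\<kappa>" \<Delta>
    unfolding \<Delta>_def by (rule tri.algebra_hom_udt_eval)
  have \<Delta>_gen: "\<Delta> (gen Gen_u) = Tri 0 1 0" "\<Delta> (gen Gen_d) = Tri 0 0 0"
      "\<Delta> (gen Gen_t) = Tri [:0, 1:] 0 [:0, 1:]"
    unfolding \<Delta>_def by (rule tri.udt_eval_gen)+
  have \<Delta>_J: "\<Delta> y \<in> {Tri 0 y 0 |y. \<phi>' dvd 1 * y}" if "y \<in> relations r' s' \<phi>'" for y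
    by (rule hom_relations[OF \<Delta>.algebra_hom_axioms J _ that])
      (auto simp: \<Delta>_gen relator_values_dual_numbers pconst.central_scalars_axioms peval_pconst zero_tri_def)
  have \<Delta>_diag: "ul (\<Delta> y) = line y" "lr (\<Delta> y) = line y" for y
    by (rule udt_hom_ext[OF pconst.algebra_hom_ul_lr(1)[OF \<Delta>.algebra_hom_axioms] line.algebra_hom_axioms]
        udt_hom_ext[OF pconst.algebra_hom_ul_lr(2)[OF \<Delta>.algebra_hom_axioms] line.algebra_hom_axioms];
        simp add: \<Delta>_gen line_gen)+
  define \<Theta> where "\<Theta> x = \<Delta> (F x)" for x
  interpret \<Theta>: algebra_hom "tri_scalar ?\<kappa>" \<Theta>
    unfolding \<Theta>_def by (rule algebra_hom_compose[OF F \<Delta>.algebra_hom_axioms])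
  define a b e where "a = ur (\<Theta> (gen Gen_u))" and "b = ur (\<Theta> (gen Gen_d))" and "e = ur (\<Theta> (gen Gen_t))"
  have \<Theta>_gen: "\<Theta> (gen Gen_u) = Tri 0 a 0" "\<Theta> (gen Gen_d) = Tri 0 b 0" "\<Theta> (gen Gen_t) = Tri h e h"
    by (simp_all add: tri.expand \<Theta>_def \<Delta>_diag F0 h_def a_def b_def e_def)
  have "\<Theta> x \<in> {Tri 0 y 0 |y. \<phi>' dvd 1 * y}" if "x \<in> relations r s \<phi>" for x
    unfolding \<Theta>_def by (rule \<Delta>_J, rule inverse_substitutions_relation_ideal[OF FG that])
  from relator_values_subset[OF \<Theta>.algebra_hom_axioms this]
  have ab: "\<phi>' dvd pcompose \<phi> h * a" "\<phi>' dvd pcompose \<phi> h * b"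
    by (auto simp: \<Theta>_gen relator_values_dual_numbers pconst.central_scalars_axioms peval_pconst)
  have der: "algebra_hom (tri_scalar ?\<kappa>)
      (\<lambda>x. Tri (pcompose (line x) h) (e * pcompose (pderiv (line x)) h) (pcompose (line x) h))"
  proof (rule algebra_hom_triI)
    show "algebra_hom ?\<kappa> (\<lambda>x. pcompose (line x) h)"
      by unfold_locales (simp_all add: line.hom_const line.hom_add line.hom_mult pcompose_add pcompose_mult)
    then show "algebra_hom ?\<kappa> (\<lambda>x. pcompose (line x) h)" .
  qed (simp_all add: line.hom_const line.hom_add line.hom_mult pderiv_pCons pderiv_add pderiv_mult
      pcompose_add pcompose_mult algebra_simps)
  \<comment> \<open>Modulo conormal directions killed by \<open>\<phi>(h)\<close>, only the derivative along the line remains.\<close>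
  have "\<Theta> x - Tri (pcompose (line x) h) (e * pcompose (pderiv (line x)) h) (pcompose (line x) h) \<in>
      {Tri 0 y 0 |y. \<phi>' dvd pcompose \<phi> h * y}" for x
    by (rule udt_hom_cong_ideal[OF \<Theta>.algebra_hom_axioms der J])
      (use ab in \<open>simp_all add: \<Theta>_gen line_gen pderiv_pCons pcompose_pCons minus_tri_def zero_tri_def\<close>)
  from this[of "G (gen Gen_u)"] obtain y
    where y: "\<Delta> (F (G (gen Gen_u))) = Tri 0 y 0" "\<phi>' dvd pcompose \<phi> h * y"
    by (auto simp: G0 \<Theta>_def minus_tri_def tri.expand zero_tri_def)
  have "\<phi>' dvd y - 1"
    using \<Delta>_J[OF FGy[of "gen Gen_u"]] by (simp add: \<Delta>.hom_diff y(1) \<Delta>_gen minus_tri_def)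
  then have "\<phi>' dvd pcompose \<phi> h * (y - 1)" by simp
  with y(2) have "\<phi>' dvd pcompose \<phi> h * y - pcompose \<phi> h * (y - 1)" by (rule dvd_diff)
  then show ?thesis by (simp add: algebra_simps h_def)
qed

text \<open>
  The substitutions \<open>h\<close> and \<open>h'\<close> on the lines are inverse to each other under composition, hence
  linear polynomials, and the two divisibilities between \<open>\<phi>(h)\<close> and \<open>\<phi>'\<close> leave only a unit.
\<close>

lemma isomorphic_imp_affine_equiv:
  fixes \<phi> \<phi>' :: "'k::field poly"
  assumes iso: "down_up_algebra r s \<phi> \<cong>\<^sub>a\<^sub>l\<^sub>g down_up_algebra r' s' \<phi>'"
    and "r \<noteq> 1" "s \<noteq> 1" "r' \<noteq> 1" "s' \<noteq> 1"
  shows "affine_equiv \<phi> \<phi>'"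
proof -
  obtain F G where FG: "inverse_substitutions (down_up_relators r s \<phi>) (down_up_relators r' s' \<phi>') F G"
    using iso by (auto simp: down_up_algebra_isomorphic_iff)
  note GF = inverse_substitutions_sym[OF FG]
  show ?thesis
  proof (cases "\<phi>' = 0")
    case True
    then have "\<phi> = 0" using line_preserved(3)[OF GF] assms by blast
    with True show ?thesis unfolding affine_equiv_def by (intro exI[of _ 1] exI[of _ 0]) simp
  next
    case False
    note F0 = line_preserved[OF FG False assms(2,3)]
    note G0 = line_preserved[OF GF F0(3) assms(4,5)]
    define h h' where "h = line (F (gen Gen_t))" and "h' = line (G (gen Gen_t))"
    have F: "algebra_hom const F" and FGy: "F (G y) - y \<in> relations r' s' \<phi>'" for y
      using FG by (auto simp: inverse_substitutions_def)
    have "pcompose h' h = line (F (G (gen Gen_t)))"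
      using line_substitution[OF F F0(1,2), of "G (gen Gen_t)"] by (simp add: h_def h'_def)
    also have "\<dots> = [:0, 1:]" using line_eq_of_diff[OF FGy] by (simp add: line_gen)
    finally have inv: "pcompose h' h = [:0, 1:]" .
    then have "Polynomial.degree h' * Polynomial.degree h = 1"
      by (metis degree_pcompose degree_pCons_eq_if one_poly_eq_simps(1) degree_1 One_nat_def zero_neq_one pCons_0_0)
    then have "Polynomial.degree h = 1" by simp
    moreover obtain b p where "h = pCons b p" by (cases h) auto
    ultimately have "h = pCons b p" "p \<noteq> 0" "Polynomial.degree p = 0"
      by (simp_all add: degree_pCons_eq_if split: if_splits)
    then obtain a where h: "h = [:b, a:]" "a \<noteq> 0" by (auto elim: degree_eq_zeroE)
    have 1: "\<phi>' dvd pcompose \<phi> h"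
      unfolding h_def by (rule conormal_dvd[OF FG F0(1,2) G0(1)])
    have "\<phi> dvd pcompose \<phi>' h'"
      unfolding h'_def by (rule conormal_dvd[OF GF G0(1,2) F0(1)])
    then obtain q where "pcompose \<phi>' h' = \<phi> * q" by (elim dvdE)
    then have "pcompose (pcompose \<phi>' h') h = pcompose \<phi> h * pcompose q h" by (simp add: pcompose_mult)
    then have q: "\<phi>' = pcompose \<phi> h * pcompose q h" by (simp add: pcompose_assoc[symmetric] inv)
    obtain p where p: "pcompose \<phi> h = \<phi>' * p" using 1 by (elim dvdE)
    have "p * pcompose q h = 1" using q p False
      by (metis mult.assoc mult_cancel_left mult.right_neutral)
    then have "is_unit p" by (metis dvdI)
    then obtain \<eta> where \<eta>: "p = [:\<eta>:]" "\<eta> dvd 1" by (auto simp: is_unit_poly_iff)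
    then have "\<eta> \<noteq> 0" by auto
    have "pcompose \<phi> [:b, a:] = Polynomial.smult \<eta> \<phi>'" using p by (simp add: h \<eta>(1))
    with h(2) \<open>\<eta> \<noteq> 0\<close> show ?thesis unfolding affine_equiv_def by blast
  qed
qed

section \<open>Laurent polynomials\<close>

type_synonym 'k laurent = "int \<Rightarrow>\<^sub>0 'k"

abbreviation lconst :: "'k::zero \<Rightarrow> 'k laurent" where
  "lconst \<equiv> Poly_Mapping.single 0"

interpretation lconst: central_scalars "lconst :: 'k::comm_ring_1 \<Rightarrow> 'k laurent"
  by standard (simp_all add: single_add mult_single mult.commute)

lemma peval_lconst: "peval lconst p (lconst c :: 'k::comm_ring_1 laurent) = lconst (poly p c)"
  by (induction p) (simp_all add: lconst.peval_zero lconst.peval_pCons mult_single single_add)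

text \<open>The automorphism \<open>z \<mapsto> z / q\<close>, where \<open>z\<close> is the variable of the Laurent polynomials.\<close>

definition twist :: "'k::field \<Rightarrow> 'k laurent \<Rightarrow> 'k laurent" where
  "twist q f = Poly_Mapping.mapp (\<lambda>n c. q powi (- n) * c) f"

lemma lookup_twist: "Poly_Mapping.lookup (twist q f) n = q powi (- n) * Poly_Mapping.lookup f n"
  by (auto simp: twist_def lookup_mapp when_def in_keys_iff)

lemma twist_add: "twist q (f + g) = twist q f + twist q g"
  by (rule poly_mapping_eqI) (simp add: lookup_twist lookup_add distrib_left)

lemma twist_single: "twist q (Poly_Mapping.single n c) = Poly_Mapping.single n (q powi (- n) * c)"
  by (rule poly_mapping_eqI) (simp add: lookup_twist lookup_single when_def)

lemma twist_zero: "twist q 0 = 0"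
  by (rule poly_mapping_eqI) (simp add: lookup_twist)

lemma twist_mult:
  assumes "q \<noteq> 0"
  shows "twist q (f * g) = twist q f * twist q g"
proof -
  have single: "twist q (Poly_Mapping.single n c * g) = twist q (Poly_Mapping.single n c) * twist q g" for n c g
  proof (induction g rule: poly_mapping_single_induct)
    case (single_add m d g)
    have "q powi (- n - m) = q powi (- n) * q powi (- m)"
      using power_int_add[of q "- n" "- m"] assms by simp
    with single_add show ?case
      by (simp add: distrib_left twist_add mult_single twist_single mult.assoc mult.left_commute)
  qed (simp add: twist_zero)
  show ?thesis
    by (induction f rule: poly_mapping_single_induct) (simp_all add: twist_zero distrib_right twist_add single)
qed

lemma algebra_hom_twist:
  assumes "algebra_hom lconst h" "q \<noteq> 0"
  shows "algebra_hom lconst (\<lambda>x. twist q (h x))"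
proof -
  interpret h: algebra_hom lconst h by fact
  show ?thesis
    by unfold_locales (simp_all add: h.hom_const h.hom_add h.hom_mult twist_add twist_single twist_mult assms(2))
qed

section \<open>Extensions of characters on a curve\<close>

text \<open>
  An extension of the character \<open>(U', D', T)\<close> by the character \<open>(U, D, T)\<close> with corner entries
  \<open>a\<close>, \<open>b\<close> at \<open>u\<close>, \<open>d\<close> is subject to two linear equations in \<open>a\<close> and \<open>b\<close>. Their diagonal
  coefficients factor and involve the parameters through \<open>d\<close> or \<open>u\<close> alone.
\<close>

lemma relator_values_skew:
  fixes \<kappa> :: "'k::field \<Rightarrow> 'c::comm_ring_1" and r s :: 'k and \<phi> :: "'k poly" and U U' D D' T a b :: 'c
  assumes "central_scalars \<kappa>"
  defines "P \<equiv> peval \<kappa> \<phi> T"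
  defines "E \<equiv> \<kappa> ((1 - r) * (1 - s)) * U * D - P" and "E' \<equiv> \<kappa> ((1 - r) * (1 - s)) * U' * D' - P"
  shows "relator_values (tri_scalar \<kappa>) r s \<phi> (Tri U a U') (Tri D b D') (Tri T 0 T) =
    {0, Tri (E * D)
      ((D - \<kappa> r * D') * (D - \<kappa> s * D') * a +
        (D * U' + D' * U' - \<kappa> (r + s) * (U' * D' + U * D) + \<kappa> (r * s) * (U * D + U * D') - P) * b)
      (E' * D'),
     Tri (E * U)
      ((D * U + D * U' - \<kappa> (r + s) * (U' * D' + U * D) + \<kappa> (r * s) * (U * D' + U' * D') - P) * a +
        (U' - \<kappa> r * U) * (U' - \<kappa> s * U) * b)
      (E' * U')}"
proof -
  interpret central_scalars \<kappa> by fact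
  have \<gamma>: "\<kappa> ((1 - r) * (1 - s)) = 1 - \<kappa> (r + s) + \<kappa> (r * s)"
    by (simp add: scalar_diff scalar_add scalar_mult scalar_one algebra_simps)
  have sym: "\<kappa> (r + s) = \<kappa> r + \<kappa> s" "\<kappa> (r * s) = \<kappa> r * \<kappa> s"
    by (simp_all add: scalar_add scalar_mult)
  show ?thesis
    unfolding relator_values_def peval_tri_diagonal P_def[symmetric] E_def E'_def \<gamma> tri_scalar_def sym
    by (simp add: tri_simps algebra_simps)
qed

text \<open>
  The inner skew derivation \<open>x \<mapsto> \<chi> x - \<chi>' x\<close> solves the two linear equations of the preceding
  lemma as soon as both diagonal entries \<open>\<chi>\<close> and \<open>\<chi>'\<close> are characters.
\<close>

lemma inner_skew_identities:
  fixes U U' D D' P \<rho> \<sigma> :: "'c::comm_ring_1"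
  defines "E \<equiv> (1 - \<rho>) * (1 - \<sigma>) * U * D - P" and "E' \<equiv> (1 - \<rho>) * (1 - \<sigma>) * U' * D' - P"
  shows "(D - \<rho> * D') * (D - \<sigma> * D') * (U - U') +
        (D * U' + D' * U' - (\<rho> + \<sigma>) * (U' * D' + U * D) + (\<rho> * \<sigma>) * (U * D + U * D') - P) * (D - D') =
        E * D - E' * D'"
    and "(D * U + D * U' - (\<rho> + \<sigma>) * (U' * D' + U * D) + (\<rho> * \<sigma>) * (U * D' + U' * D') - P) * (U - U') +
        (U' - \<rho> * U) * (U' - \<sigma> * U) * (D - D') = E * U - E' * U'"
  unfolding E_def E'_def by (simp_all add: algebra_simps)

text \<open>
  The curve \<open>d = z, u = p / z, t = 0\<close>, which lies on the surface of characters for a suitable \<open>p\<close>.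
\<close>

definition curve :: "'k::field \<Rightarrow> (udt, 'k) free_alg \<Rightarrow> 'k laurent" where
  "curve p = udt_eval lconst (Poly_Mapping.single (-1) p) (Poly_Mapping.single 1 1) 0"

interpretation curve: algebra_hom lconst "curve p"
  unfolding curve_def by (rule lconst.algebra_hom_udt_eval)

lemma curve_gen:
  "curve p (gen Gen_u) = Poly_Mapping.single (-1) p" "curve p (gen Gen_d) = Poly_Mapping.single 1 1"
  "curve p (gen Gen_t) = 0"
  by (simp_all only: curve_def lconst.udt_eval_gen)

lemma curve_relations:
  assumes "(1 - r) * (1 - s) * p = poly \<phi> 0" and "x \<in> relations r s \<phi>"
  shows "curve p x = 0"
proof -
  have "relator_values lconst r s \<phi> (curve p (gen Gen_u)) (curve p (gen Gen_d)) (curve p (gen Gen_t)) \<subseteq> {0}"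
    using peval_lconst[of \<phi> 0] assms(1)
    by (simp add: curve_gen relator_values_commutative lconst.central_scalars_axioms mult_single)
  then show ?thesis
    using hom_relations[OF curve.algebra_hom_axioms two_sided_ideal_singleton_zero _ assms(2)] by blast
qed

text \<open>
  For \<open>q \<in> {r, s}\<close> the skew derivation between the points \<open>z\<close> and \<open>z / q\<close> of the curve with values
  \<open>1\<close> at \<open>u\<close> and \<open>0\<close> at \<open>d\<close> and \<open>t\<close> respects the relations, because the coefficients of its
  value at \<open>u\<close> vanish in both linear equations. It is not proportional to the inner one, and this remains true after
  composition with \<open>G\<close>. So the linear equations for the second algebra have two independent
  solutions, \<open>(\<alpha>, \<beta>)\<close> and the inner one, and all their coefficients vanish; the factored ones
  are the claim.
\<close>

lemma curve_skew_equations: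
  fixes \<phi> \<phi>' :: "'k::field poly"
  assumes FG: "inverse_substitutions (down_up_relators r s \<phi>) (down_up_relators r' s' \<phi>') F G"
    and p: "(1 - r) * (1 - s) * p = poly \<phi> 0"
    and q: "q = r \<or> q = s" "q \<noteq> 0" "q \<noteq> 1"
  defines "U \<equiv> curve p (G (gen Gen_u))" and "D \<equiv> curve p (G (gen Gen_d))" and "T \<equiv> curve p (G (gen Gen_t))"
  shows "twist q T = T"
    and "(D - lconst r' * twist q D) * (D - lconst s' * twist q D) = 0"
    and "(twist q U - lconst r' * U) * (twist q U - lconst s' * U) = 0"
proof -
  interpret tri: central_scalars "tri_scalar (lconst :: 'k \<Rightarrow> 'k laurent)" by (rule lconst.central_scalars_tri)
  have F: "algebra_hom const F" and G: "algebra_hom const G"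
    and FGy: "F (G y) - y \<in> relations r' s' \<phi>'" and GFx: "G (F x) - x \<in> relations r s \<phi>" for x y
    using FG by (auto simp: inverse_substitutions_def)
  let ?z = "Poly_Mapping.single 1 1 :: 'k laurent"
  have twist_gen: "twist q (curve p (gen Gen_u)) = Poly_Mapping.single (-1) (q * p)"
      "twist q (curve p (gen Gen_d)) = Poly_Mapping.single 1 (1 / q)" "twist q (curve p (gen Gen_t)) = 0"
    by (simp_all add: curve_gen twist_single twist_zero power_int_minus divide_inverse)
  define \<Delta> where "\<Delta> = udt_eval (tri_scalar lconst) (Tri (Poly_Mapping.single (-1) p) 1 (Poly_Mapping.single (-1) (q * p)))
    (Tri ?z 0 (Poly_Mapping.single 1 (1 / q))) (Tri 0 0 0)"
  interpret \<Delta>: algebra_hom "tri_scalar lconst" \<Delta>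
    unfolding \<Delta>_def by (rule tri.algebra_hom_udt_eval)
  have \<Delta>_gen: "\<Delta> (gen Gen_u) = Tri (Poly_Mapping.single (-1) p) 1 (Poly_Mapping.single (-1) (q * p))"
      "\<Delta> (gen Gen_d) = Tri ?z 0 (Poly_Mapping.single 1 (1 / q))" "\<Delta> (gen Gen_t) = Tri 0 0 0"
    unfolding \<Delta>_def by (rule tri.udt_eval_gen)+
  have "relator_values (tri_scalar lconst) r s \<phi> (\<Delta> (gen Gen_u)) (\<Delta> (gen Gen_d)) (\<Delta> (gen Gen_t)) \<subseteq> {0}"
  proof -
    \<comment> \<open>The coefficient of \<open>a\<close> in the last relator, with the powers of \<open>z\<close> cancelled\<close>
    have "p + q * p - ((r + s) * (p + p)) + r * s * (p / q + p) - poly \<phi> 0 = 0"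
      using q by (auto simp: p[symmetric] field_simps)
    then have M21: "Poly_Mapping.single 1 1 * Poly_Mapping.single (-1) p + Poly_Mapping.single 1 1 * Poly_Mapping.single (-1) (q * p) -
        lconst (r + s) * (Poly_Mapping.single (-1) (q * p) * Poly_Mapping.single 1 (1 / q) + Poly_Mapping.single (-1) p * Poly_Mapping.single 1 1) +
        lconst (r * s) * (Poly_Mapping.single (-1) p * Poly_Mapping.single 1 (1 / q) + Poly_Mapping.single (-1) (q * p) * Poly_Mapping.single 1 (1 / q)) -
        lconst (poly \<phi> 0) = (0 :: 'k laurent)"
      using q(2) by (simp add: mult_single flip: single_add single_diff)
    have M11: "(Poly_Mapping.single 1 1 - lconst r * Poly_Mapping.single 1 (1 / q)) *
        (Poly_Mapping.single 1 1 - lconst s * Poly_Mapping.single 1 (1 / q)) = (0 :: 'k laurent)"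
      using q by (auto simp: mult_single simp flip: single_diff)
    have E: "lconst ((1 - r) * (1 - s)) * Poly_Mapping.single (-1) p * Poly_Mapping.single 1 1 - lconst (poly \<phi> 0) = (0 :: 'k laurent)"
      "lconst ((1 - r) * (1 - s)) * Poly_Mapping.single (-1) (q * p) * Poly_Mapping.single 1 (1 / q) - lconst (poly \<phi> 0) = (0 :: 'k laurent)"
      using q(2) by (simp_all add: mult_single p[symmetric] mult.assoc)
    have P: "peval lconst \<phi> 0 = (lconst (poly \<phi> 0) :: 'k laurent)"
      using peval_lconst[of \<phi> 0] by simp
    show ?thesis
      unfolding \<Delta>_gen relator_values_skew[OF lconst.central_scalars_axioms] P M21 M11 E
      by (simp add: zero_tri_def)
  qed
  then have \<Delta>_zero: "\<Delta> x = 0" if "x \<in> relations r s \<phi>" for x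
    using hom_relations[OF \<Delta>.algebra_hom_axioms two_sided_ideal_singleton_zero _ that] by simp
  have twist_curve: "algebra_hom lconst (\<lambda>x. twist q (curve p x))"
    by (rule algebra_hom_twist[OF curve.algebra_hom_axioms q(2)])
  have \<Delta>_diag: "ul (\<Delta> x) = curve p x" "lr (\<Delta> x) = twist q (curve p x)" for x
    by (rule udt_hom_ext[OF lconst.algebra_hom_ul_lr(1)[OF \<Delta>.algebra_hom_axioms] curve.algebra_hom_axioms]
        udt_hom_ext[OF lconst.algebra_hom_ul_lr(2)[OF \<Delta>.algebra_hom_axioms] twist_curve];
        simp only: \<Delta>_gen curve_gen twist_gen[unfolded curve_gen] tri.sel)+
  define \<Theta> where "\<Theta> y = \<Delta> (G y)" for y
  interpret \<Theta>: algebra_hom "tri_scalar lconst" \<Theta>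
    unfolding \<Theta>_def by (rule algebra_hom_compose[OF G \<Delta>.algebra_hom_axioms])
  define \<chi> where "\<chi> y = curve p (G y)" for y
  have \<chi>: "algebra_hom lconst \<chi>"
    unfolding \<chi>_def by (rule algebra_hom_compose[OF G curve.algebra_hom_axioms])
  have \<chi>': "algebra_hom lconst (\<lambda>y. twist q (\<chi> y))" by (rule algebra_hom_twist[OF \<chi> q(2)])
  have \<Theta>_diag: "ul (\<Theta> y) = \<chi> y" "lr (\<Theta> y) = twist q (\<chi> y)" for y
    by (simp_all add: \<Theta>_def \<Delta>_diag \<chi>_def)
  have \<Theta>F: "\<Theta> (F x) = \<Delta> x" for x
    using \<Delta>_zero[OF GFx[of x]] by (simp add: \<Theta>_def \<Delta>.hom_diff)
  define U' D' T' where "U' = twist q U" and "D' = twist q D" and "T' = twist q T"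
  define \<alpha> \<beta> \<tau> where "\<alpha> = ur (\<Theta> (gen Gen_u))" and "\<beta> = ur (\<Theta> (gen Gen_d))" and "\<tau> = ur (\<Theta> (gen Gen_t))"
  have \<chi>_gen: "\<chi> (gen Gen_u) = U" "\<chi> (gen Gen_d) = D" "\<chi> (gen Gen_t) = T"
    by (simp_all add: \<chi>_def U_def D_def T_def)
  have \<Theta>_gen: "\<Theta> (gen Gen_u) = Tri U \<alpha> U'" "\<Theta> (gen Gen_d) = Tri D \<beta> D'" "\<Theta> (gen Gen_t) = Tri T \<tau> T'"
    by (simp_all add: tri.expand \<Theta>_diag \<chi>_gen \<alpha>_def \<beta>_def \<tau>_def U'_def D'_def T'_def)
  \<comment> \<open>No nonzero multiple of the extension pulled back along \<open>G\<close> is a multiple of the inner one, because this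
    would be true of the original extension as well: compare the values at \<open>d\<close>, and then at \<open>u\<close>.\<close>
  have not_inner: "\<omega> = 0 \<and> \<nu> = 0"
    if "\<omega> * \<alpha> = \<nu> * (U - U')" "\<omega> * \<beta> = \<nu> * (D - D')" "\<omega> * \<tau> = \<nu> * (T - T')" for \<omega> \<nu>
  proof -
    have ur_hom: "ur (\<Theta> (const c)) = 0" "ur (\<Theta> (x + y)) = ur (\<Theta> x) + ur (\<Theta> y)"
      "ur (\<Theta> (x * y)) = \<chi> x * ur (\<Theta> y) + ur (\<Theta> x) * twist q (\<chi> y)" for c x y
      by (simp_all add: \<Theta>.hom_const \<Theta>.hom_add \<Theta>.hom_mult tri_scalar_def plus_tri_def times_tri_def \<Theta>_diag)
    have "algebra_hom (tri_scalar lconst) (\<lambda>y. Tri (\<chi> y) (\<omega> * ur (\<Theta> y)) (twist q (\<chi> y)))"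
      by (rule algebra_hom_triI[OF \<chi> \<chi>']) (simp_all add: ur_hom algebra_simps)
    moreover have "algebra_hom (tri_scalar lconst) (\<lambda>y. Tri (\<chi> y) (\<nu> * (\<chi> y - twist q (\<chi> y))) (twist q (\<chi> y)))"
      by (rule algebra_hom_triI[OF \<chi> \<chi>'])
        (simp_all add: algebra_hom.hom_const[OF \<chi>] algebra_hom.hom_add[OF \<chi>] algebra_hom.hom_mult[OF \<chi>]
          twist_single twist_add twist_mult q(2) algebra_simps)
    ultimately have "Tri (\<chi> y) (\<omega> * ur (\<Theta> y)) (twist q (\<chi> y)) =
        Tri (\<chi> y) (\<nu> * (\<chi> y - twist q (\<chi> y))) (twist q (\<chi> y))" for y
      by (rule udt_hom_ext) (use that in \<open>simp_all add: \<chi>_gen \<Theta>_gen U'_def D'_def T'_def\<close>)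
    then have eq: "\<omega> * ur (\<Theta> y) = \<nu> * (\<chi> y - twist q (\<chi> y))" for y by simp
    have "\<chi> (F x) = curve p x" for x
      using \<Theta>_diag(1)[of "F x"] by (simp add: \<Theta>F \<Delta>_diag)
    with eq[of "F x" for x] \<Theta>F have eq': "\<omega> * ur (\<Delta> x) = \<nu> * (curve p x - twist q (curve p x))" for x
      by metis
    have "\<nu> * Poly_Mapping.single 1 (1 - 1 / q) = 0"
      using eq'[of "gen Gen_d"] by (simp add: \<Delta>_gen twist_gen) (simp add: curve_gen single_diff)
    moreover have "Poly_Mapping.single 1 (1 - 1 / q) \<noteq> (0 :: 'k laurent)"
      using q(2,3) by (metis lookup_single_eq lookup_zero right_minus_eq divide_eq_1_iff)
    ultimately have "\<nu> = 0" by simp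
    with eq'[of "gen Gen_u"] show ?thesis by (simp add: \<Delta>_gen)
  qed
  have "\<Theta> y \<in> {0}" if "y \<in> relations r' s' \<phi>'" for y
    using \<Delta>_zero[OF inverse_substitutions_relation_ideal[OF inverse_substitutions_sym[OF FG] that]]
    by (simp add: \<Theta>_def)
  from relator_values_subset[OF \<Theta>.algebra_hom_axioms this]
  have rel: "relator_values (tri_scalar lconst) r' s' \<phi>' (Tri U \<alpha> U') (Tri D \<beta> D') (Tri T \<tau> T') \<subseteq> {0}"
    by (simp add: \<Theta>_gen)
  \<comment> \<open>As \<open>t\<close> is central, the extension times \<open>T - T'\<close> is \<open>\<tau>\<close> times the inner one.\<close>
  then have "(T - T') * \<alpha> = \<tau> * (U - U')" "(T - T') * \<beta> = \<tau> * (D - D')"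
    by (simp_all add: relator_values_def tri_simps algebra_simps)
  then have "T - T' = 0 \<and> \<tau> = 0" by (rule not_inner) simp
  then have T: "T' = T" "\<tau> = 0" by simp_all
  then show "twist q T = T" by (simp add: T'_def)
  define P where "P = peval lconst \<phi>' T"
  define \<rho> \<sigma> where "\<rho> = (lconst r' :: 'k laurent)" and "\<sigma> = (lconst s' :: 'k laurent)"
  have \<rho>\<sigma>: "lconst ((1 - r') * (1 - s')) = (1 - \<rho>) * (1 - \<sigma>)" "lconst (r' + s') = \<rho> + \<sigma>" "lconst (r' * s') = \<rho> * \<sigma>"
    by (simp_all only: \<rho>_def \<sigma>_def lconst.scalar_mult lconst.scalar_diff lconst.scalar_add lconst.scalar_one)
  define M11 M12 where "M11 = (D - \<rho> * D') * (D - \<sigma> * D')"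
    and "M12 = D * U' + D' * U' - (\<rho> + \<sigma>) * (U' * D' + U * D) + (\<rho> * \<sigma>) * (U * D + U * D') - P"
  define M21 M22 where "M21 = D * U + D * U' - (\<rho> + \<sigma>) * (U' * D' + U * D) + (\<rho> * \<sigma>) * (U * D' + U' * D') - P"
    and "M22 = (U' - \<rho> * U) * (U' - \<sigma> * U)"
  have zero: "((1 - \<rho>) * (1 - \<sigma>) * U * D - P) * D = 0" "((1 - \<rho>) * (1 - \<sigma>) * U' * D' - P) * D' = 0"
    "((1 - \<rho>) * (1 - \<sigma>) * U * D - P) * U = 0" "((1 - \<rho>) * (1 - \<sigma>) * U' * D' - P) * U' = 0"
    and lin: "M11 * \<alpha> + M12 * \<beta> = 0" "M21 * \<alpha> + M22 * \<beta> = 0"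
    using rel unfolding T relator_values_skew[OF lconst.central_scalars_axioms] \<rho>\<sigma>
      P_def[symmetric] M11_def M12_def M21_def M22_def zero_tri_def
    by (simp_all add: \<rho>_def[symmetric] \<sigma>_def[symmetric] del: mult_eq_0_iff)
  have inner: "M11 * (U - U') + M12 * (D - D') = 0" "M21 * (U - U') + M22 * (D - D') = 0"
    unfolding M11_def M12_def M21_def M22_def inner_skew_identities zero by simp_all
  \<comment> \<open>Cramer's rule for the two solutions of the linear equations\<close>
  define det where "det = \<alpha> * (D - D') - \<beta> * (U - U')"
  have "det \<noteq> 0"
  proof
    assume "det = 0"
    then have det: "(D - D') * \<alpha> = \<beta> * (U - U')" "(U - U') * \<beta> = \<alpha> * (D - D')"
      by (simp_all add: det_def algebra_simps)
    have "D - D' = 0 \<and> \<beta> = 0" by (rule not_inner) (simp_all add: det T)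
    moreover have "U - U' = 0 \<and> \<alpha> = 0" by (rule not_inner) (simp_all add: det T)
    ultimately have "(1 :: 'k laurent) = 0 \<and> (0 :: 'k laurent) = 0" by (intro not_inner) (simp_all add: T)
    then show False by simp
  qed
  moreover have "M11 * det = 0" "M22 * det = 0"
  proof -
    have "M11 * det = (M11 * \<alpha> + M12 * \<beta>) * (D - D') - \<beta> * (M11 * (U - U') + M12 * (D - D'))"
      "M22 * det = \<alpha> * (M21 * (U - U') + M22 * (D - D')) - (M21 * \<alpha> + M22 * \<beta>) * (U - U')"
      by (simp_all add: det_def algebra_simps)
    then show "M11 * det = 0" "M22 * det = 0" by (simp_all add: lin inner)
  qed
  ultimately show "(D - lconst r' * twist q D) * (D - lconst s' * twist q D) = 0"
      "(twist q U - lconst r' * U) * (twist q U - lconst s' * U) = 0"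
    by (simp_all add: M11_def M22_def \<rho>_def \<sigma>_def U'_def D'_def)
qed

section \<open>The parameters\<close>

lemma admissible_nontrivial: "admissible q \<Longrightarrow> q \<noteq> 0 \<and> q \<noteq> 1"
  by (auto simp: admissible_def root_of_unity_def intro: exI[of _ 1])

lemma power_int_inj_of_not_root_of_unity:
  fixes q :: "'k::field"
  assumes "q \<noteq> 0" "\<not> root_of_unity q" "q powi m = q powi n"
  shows "m = n"
proof -
  have one: "k = 0" if "q ^ k = 1" for k
    using that assms(2) by (auto simp: root_of_unity_def)
  have "q powi (m - n) = 1" using assms by (simp add: power_int_diff)
  moreover have "q powi (n - m) = 1" using assms by (simp add: power_int_diff)
  ultimately show ?thesis using one[of "nat (m - n)"] one[of "nat (n - m)"]
    by (cases "m \<ge> n") (auto simp: power_int_def)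
qed

lemma lookup_lconst_mult: "Poly_Mapping.lookup (lconst c * f) n = c * Poly_Mapping.lookup f n"
  by (simp add: mult_map_scale_conv_mult[symmetric] Poly_Mapping.map.rep_eq when_def)

text \<open>The monomial \<open>z\<^sup>n\<close> is an eigenvector of the twist, with eigenvalue \<open>q\<^sup>-\<^sup>n\<close>.\<close>

lemma twist_eigenvector_support:
  assumes "twist q f = lconst c * f" and "Poly_Mapping.lookup f n \<noteq> 0"
  shows "q powi (- n) = c"
proof -
  have "q powi (- n) * Poly_Mapping.lookup f n = c * Poly_Mapping.lookup f n"
    using arg_cong[OF assms(1), of "\<lambda>g. Poly_Mapping.lookup g n"]
    by (simp add: lookup_twist lookup_lconst_mult)
  with assms(2) show ?thesis by simp
qed

lemma twist_eigenvector_support':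
  assumes "f = lconst c * twist q f" and "Poly_Mapping.lookup f n \<noteq> 0" and "q \<noteq> 0"
  shows "q powi n = c"
proof -
  have "Poly_Mapping.lookup f n = c * (q powi (- n) * Poly_Mapping.lookup f n)"
    using arg_cong[OF assms(1), of "\<lambda>g. Poly_Mapping.lookup g n"]
    by (simp add: lookup_twist lookup_lconst_mult)
  with assms(2,3) show ?thesis by (simp add: power_int_minus field_simps)
qed

text \<open>The Laurent polynomials in \<open>z\<^sup>n\<close> form a subalgebra.\<close>

lemma hom_laurent_support:
  fixes h :: "(udt, 'k::comm_ring_1) free_alg \<Rightarrow> 'k laurent"
  assumes h: "algebra_hom lconst h"
    and gens: "\<And>g k. Poly_Mapping.lookup (h (gen g)) k \<noteq> 0 \<Longrightarrow> n dvd k"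
  shows "Poly_Mapping.lookup (h x) k \<noteq> 0 \<Longrightarrow> n dvd k"
proof (induction x arbitrary: k rule: free_alg_induct)
  case (const c)
  then show ?case by (auto simp: algebra_hom.hom_const[OF h] lookup_single when_def split: if_splits)
next
  case (gen g)
  then show ?case by (rule gens)
next
  case (add x y)
  then have "Poly_Mapping.lookup (h x) k \<noteq> 0 \<or> Poly_Mapping.lookup (h y) k \<noteq> 0"
    by (auto simp: algebra_hom.hom_add[OF h] lookup_add)
  with add.IH show ?case by blast
next
  case (mult x y)
  then have "k \<in> Poly_Mapping.keys (h x * h y)" by (simp add: algebra_hom.hom_mult[OF h] in_keys_iff)
  then obtain i j where "k = i + j" "i \<in> Poly_Mapping.keys (h x)" "j \<in> Poly_Mapping.keys (h y)"
    using keys_mult[of "h x" "h y"] by auto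
  with mult.IH show ?case by (simp add: in_keys_iff)
qed

lemma eq_single_of_support:
  "(\<And>m. Poly_Mapping.lookup f m \<noteq> 0 \<Longrightarrow> m = n) \<Longrightarrow> f = Poly_Mapping.single n (Poly_Mapping.lookup f n)"
  by (rule poly_mapping_eqI) (auto simp: lookup_single when_def)

text \<open>
  By the skew equations, \<open>U\<close>, \<open>D\<close> and \<open>T\<close> are eigenvectors of the twists by \<open>r\<close> and \<open>s\<close>, so
  \<open>T\<close> is constant and \<open>U\<close> and \<open>D\<close> are monomials. If neither of these vanishes, \<open>U D\<close> is constant,
  as the pulled back character lies on the surface of the second algebra. In all cases there is
  one \<open>n\<close> such that the image consists of Laurent polynomials in \<open>z\<^sup>n\<close>. It contains \<open>z\<close>, so
  \<open>n\<close> is \<open>\<plusminus> 1\<close>, and the eigenvalues of the nonzero one among \<open>D\<close> and \<open>U\<close> show that \<open>r\<^sup>n\<close> and \<open>s\<^sup>n\<close>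
  belong to \<open>{r', s'}\<close>.
\<close>

lemma isomorphic_imp_parameters:
  fixes \<phi> \<phi>' :: "'k::field poly"
  assumes iso: "down_up_algebra r s \<phi> \<cong>\<^sub>a\<^sub>l\<^sub>g down_up_algebra r' s' \<phi>'"
    and adm: "admissible r" "admissible s" and "r \<noteq> s" "r' \<noteq> 1" "s' \<noteq> 1"
  shows "{r, s} = {r', s'} \<or> {inverse r, inverse s} = {r', s'}"
proof -
  obtain F G where FG: "inverse_substitutions (down_up_relators r s \<phi>) (down_up_relators r' s' \<phi>') F G"
    using iso by (auto simp: down_up_algebra_isomorphic_iff)
  have nz: "q \<noteq> 0" "q \<noteq> 1" and nru: "\<not> root_of_unity q" if "q \<in> {r, s}" for q
    using adm that admissible_nontrivial by (auto simp: admissible_def)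
  define p where "p = poly \<phi> 0 / ((1 - r) * (1 - s))"
  have p: "(1 - r) * (1 - s) * p = poly \<phi> 0" using nz by (auto simp: p_def)
  define h where "h y = curve p (G y)" for y
  have G: "algebra_hom const G" and GFx: "G (F x) - x \<in> relations r s \<phi>" for x
    using FG by (auto simp: inverse_substitutions_def)
  have h: "algebra_hom lconst h"
    unfolding h_def by (rule algebra_hom_compose[OF G curve.algebra_hom_axioms])
  define U D T where "U = h (gen Gen_u)" and "D = h (gen Gen_d)" and "T = h (gen Gen_t)"
  have skew: "twist q T = T" "(D - lconst r' * twist q D) * (D - lconst s' * twist q D) = 0"
      "(twist q U - lconst r' * U) * (twist q U - lconst s' * U) = 0" if "q \<in> {r, s}" for q
    using curve_skew_equations[OF FG p, of q] nz[OF that] that by (auto simp: U_def D_def T_def h_def)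
  have D: "\<exists>c\<in>{r', s'}. D = lconst c * twist q D" if "q \<in> {r, s}" for q
    using skew(2)[OF that] by auto
  have U: "\<exists>c\<in>{r', s'}. twist q U = lconst c * U" if "q \<in> {r, s}" for q
    using skew(3)[OF that] by auto
  have D_pow: "q powi n \<in> {r', s'}" if "q \<in> {r, s}" "Poly_Mapping.lookup D n \<noteq> 0" for q n
    using D[OF that(1)] twist_eigenvector_support'[of D _ q n] that nz[OF that(1)] by blast
  have U_pow: "q powi (- n) \<in> {r', s'}" if "q \<in> {r, s}" "Poly_Mapping.lookup U n \<noteq> 0" for q n
    using U[OF that(1)] twist_eigenvector_support[of q U _ n] that by blast
  have inj: "m = n" if "r powi m = r powi n" for m n
    using power_int_inj_of_not_root_of_unity[of r m n] nz nru that by simp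
  have D_single: "m = n" if "Poly_Mapping.lookup D m \<noteq> 0" "Poly_Mapping.lookup D n \<noteq> 0" for m n
    using D[of r] twist_eigenvector_support'[of D _ r m] twist_eigenvector_support'[of D _ r n] that nz[of r] inj
    by (metis insertI1)
  have U_single: "m = n" if "Poly_Mapping.lookup U m \<noteq> 0" "Poly_Mapping.lookup U n \<noteq> 0" for m n
    using U[of r] twist_eigenvector_support[of r U _ m] twist_eigenvector_support[of r U _ n] that inj[of "- m" "- n"]
    by (metis insertI1 neg_equal_iff_equal)
  have T_const: "n = 0" if "Poly_Mapping.lookup T n \<noteq> 0" for n
    using twist_eigenvector_support[of r T 1 n] skew(1)[of r] that inj[of "- n" 0] by simp
  have UD: "m + n = 0" if m: "Poly_Mapping.lookup U m \<noteq> 0" and n: "Poly_Mapping.lookup D n \<noteq> 0" for m n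
  proof -
    have "h y \<in> {0}" if "y \<in> relations r' s' \<phi>'" for y
      using curve_relations[OF p inverse_substitutions_relation_ideal[OF inverse_substitutions_sym[OF FG] that]]
      by (simp add: h_def)
    from relator_values_subset[OF h this]
    have "(lconst ((1 - r') * (1 - s')) * U * D - peval lconst \<phi>' T) * D = 0"
      by (simp add: relator_values_commutative lconst.central_scalars_axioms U_def D_def T_def)
    moreover have "D \<noteq> 0" using n by auto
    ultimately have "lconst ((1 - r') * (1 - s')) * U * D = peval lconst \<phi>' T" by simp
    moreover have "U = Poly_Mapping.single m (Poly_Mapping.lookup U m)"
      by (rule eq_single_of_support) (rule U_single[OF _ m])
    moreover have "D = Poly_Mapping.single n (Poly_Mapping.lookup D n)"
      by (rule eq_single_of_support) (rule D_single[OF _ n])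
    moreover have "T = lconst (Poly_Mapping.lookup T 0)"
      by (rule eq_single_of_support) (rule T_const)
    ultimately have "lconst ((1 - r') * (1 - s')) * Poly_Mapping.single m (Poly_Mapping.lookup U m) *
        Poly_Mapping.single n (Poly_Mapping.lookup D n) = lconst (poly \<phi>' (Poly_Mapping.lookup T 0))"
      by (metis peval_lconst)
    then have "Poly_Mapping.single (m + n) ((1 - r') * (1 - s') * Poly_Mapping.lookup U m * Poly_Mapping.lookup D n) =
        lconst (poly \<phi>' (Poly_Mapping.lookup T 0))"
      by (simp add: mult_single)
    from arg_cong[OF this, of "\<lambda>f. Poly_Mapping.lookup f (m + n)"] show ?thesis
      using m n assms(5,6) by (auto simp: lookup_single when_def split: if_splits)
  qed
  \<comment> \<open>The value \<open>n = 0\<close> covers the case \<open>U = D = 0\<close> and is excluded below, since \<open>0\<close> does not divide \<open>1\<close>.\<close>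
  obtain n where n: "\<And>k. Poly_Mapping.lookup U k \<noteq> 0 \<Longrightarrow> n dvd k" "\<And>k. Poly_Mapping.lookup D k \<noteq> 0 \<Longrightarrow> n dvd k"
    and pow: "n = 0 \<or> (\<forall>q\<in>{r, s}. q powi n \<in> {r', s'})"
  proof (cases "D = 0")
    case False
    then obtain n where "Poly_Mapping.lookup D n \<noteq> 0" by (metis poly_mapping_eqI lookup_zero)
    then show ?thesis using that[of n] UD D_single D_pow by (metis dvd_refl dvd_minus_iff eq_neg_iff_add_eq_0)
  next
    case D0: True
    show ?thesis
    proof (cases "U = 0")
      case False
      then obtain n where n: "Poly_Mapping.lookup U n \<noteq> 0" by (metis poly_mapping_eqI lookup_zero)
      have "- n dvd k" if "Poly_Mapping.lookup U k \<noteq> 0" for k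
        using U_single[OF that n] by simp
      then show ?thesis using that[of "- n"] U_pow[OF _ n] by (simp add: D0)
    qed (use that[of 0] D0 in auto)
  qed
  have "n dvd k" if "Poly_Mapping.lookup (h (gen g)) k \<noteq> 0" for g k
    using that n T_const by (cases g) (auto simp: U_def D_def T_def)
  note support = hom_laurent_support[OF h this]
  have "h (F (gen Gen_d)) = Poly_Mapping.single 1 1"
    using curve_relations[OF p GFx[of "gen Gen_d"]] by (simp add: curve.hom_diff h_def curve_gen)
  then have "n dvd 1" using support[where x = "F (gen Gen_d)" and k = 1] by simp
  then have "n = 1 \<or> n = - 1" by auto
  with pow have "(r \<in> {r', s'} \<and> s \<in> {r', s'}) \<or> (inverse r \<in> {r', s'} \<and> inverse s \<in> {r', s'})"
    by (auto simp: power_int_minus)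
  with \<open>r \<noteq> s\<close> show ?thesis by (auto simp: doubleton_eq_iff)
qed

section \<open>The classification\<close>

lemma mult_independent_distinct:
  assumes "mult_independent r s" "r \<noteq> 0"
  shows "r \<noteq> s"
proof
  assume "r = s"
  then have "r powi 1 * s powi (- 1) = 1" using assms(2) by (simp add: power_int_minus)
  then have "(1 :: int) = 0" using assms(1) unfolding mult_independent_def by blast
  then show False by simp
qed

lemma mult_independent_swap: "mult_independent r s \<Longrightarrow> mult_independent s r"
  unfolding mult_independent_def by (metis mult.commute)

lemma mult_independent_inverse:
  assumes "mult_independent r s"
  shows "mult_independent (inverse r) (inverse s)"
  unfolding mult_independent_def
proof (intro allI impI)
  fix i j :: int
  assume "inverse r powi i * inverse s powi j = 1"
  then have "r powi (- i) * s powi (- j) = 1"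
    by (simp add: power_int_minus power_int_inverse)
  then have "- i = 0 \<and> - j = 0" using assms unfolding mult_independent_def by blast
  then show "i = 0 \<and> j = 0" by simp
qed

lemma mult_independent_of_parameters:
  assumes "mult_independent r s" and "{r, s} = {r', s'} \<or> {inverse r, inverse s} = {r', s'}"
  shows "mult_independent r' s'"
  using assms mult_independent_swap mult_independent_inverse by (metis doubleton_eq_iff)

lemma affine_equiv_smult: "affine_equiv \<phi> \<psi> \<Longrightarrow> c \<noteq> 0 \<Longrightarrow> affine_equiv (Polynomial.smult c \<phi>) \<psi>"
  unfolding affine_equiv_def by (metis mult_eq_0_iff pcompose_smult smult_smult)

lemma isomorphic_of_inverse_parameters:
  assumes "affine_equiv \<phi> \<psi>" "r \<noteq> 0" "s \<noteq> 0"
  shows "down_up_algebra r s \<phi> \<cong>\<^sub>a\<^sub>l\<^sub>g down_up_algebra (inverse r) (inverse s) \<psi>"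
  using down_up_isomorphic_trans[OF exchange_isomorphic[OF assms(2,3)]
    affine_equiv_imp_isomorphic[OF affine_equiv_smult[OF assms(1)]]] assms(2,3)
  by (simp add: inverse_eq_divide)

lemma isomorphic_iff_affine_equiv:
  fixes r s :: "'k::field"
  assumes "r \<noteq> 1" "s \<noteq> 1"
  shows "down_up_algebra r s \<phi> \<cong>\<^sub>a\<^sub>l\<^sub>g down_up_algebra r s \<psi> \<longleftrightarrow> affine_equiv \<phi> \<psi>"
  using isomorphic_imp_affine_equiv[OF _ assms assms] affine_equiv_imp_isomorphic by blast

lemma isomorphic_iff_distinct_parameters:
  fixes r s r' s' :: "'k::field"
  assumes "admissible r" "admissible s" "admissible r'" "admissible s'" "r \<noteq> s"
  shows "down_up_algebra r s \<phi> \<cong>\<^sub>a\<^sub>l\<^sub>g down_up_algebra r' s' \<phi>' \<longleftrightarrow>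
    ({r, s} = {r', s'} \<or> {inverse r, inverse s} = {r', s'}) \<and> affine_equiv \<phi> \<phi>'"
proof
  note nontrivial = assms(1-4)[THEN admissible_nontrivial]
  show "({r, s} = {r', s'} \<or> {inverse r, inverse s} = {r', s'}) \<and> affine_equiv \<phi> \<phi>'"
    if "down_up_algebra r s \<phi> \<cong>\<^sub>a\<^sub>l\<^sub>g down_up_algebra r' s' \<phi>'"
    using isomorphic_imp_parameters[OF that assms(1,2,5)] isomorphic_imp_affine_equiv[OF that] nontrivial by blast
  show "down_up_algebra r s \<phi> \<cong>\<^sub>a\<^sub>l\<^sub>g down_up_algebra r' s' \<phi>'"
    if eq: "({r, s} = {r', s'} \<or> {inverse r, inverse s} = {r', s'}) \<and> affine_equiv \<phi> \<phi>'"
  proof -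
    have aff: "affine_equiv \<phi> \<phi>'" using eq by blast
    have "r \<noteq> 0" "s \<noteq> 0" using nontrivial by auto
    moreover have "down_up_algebra r' s' \<phi>' = down_up_algebra r s \<phi>' \<or>
        down_up_algebra r' s' \<phi>' = down_up_algebra (inverse r) (inverse s) \<phi>'"
      using eq by (auto simp: doubleton_eq_iff intro: down_up_algebra_commute)
    ultimately show ?thesis
      using affine_equiv_imp_isomorphic[OF aff, of r s] isomorphic_of_inverse_parameters[OF aff] by metis
  qed
qed

theorem theorem3p2:
  shows
   "(\<forall>(r\<^sub>1::'k::field_char_0) s\<^sub>1 r\<^sub>2 s\<^sub>2 \<phi>\<^sub>1 \<phi>\<^sub>2.
       admissible r\<^sub>1 \<and> admissible s\<^sub>1 \<and> admissible r\<^sub>2 \<and> admissible s\<^sub>2 \<and>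
       mult_independent r\<^sub>1 s\<^sub>1 \<and> \<not> mult_independent r\<^sub>2 s\<^sub>2 \<longrightarrow>
       \<not> down_up_algebra r\<^sub>1 s\<^sub>1 \<phi>\<^sub>1 \<cong>\<^sub>a\<^sub>l\<^sub>g down_up_algebra r\<^sub>2 s\<^sub>2 \<phi>\<^sub>2) \<and>
    (\<forall>(r::'k) s \<phi>\<^sub>1 \<phi>\<^sub>2.
       admissible r \<and> admissible s \<and> mult_independent r s \<longrightarrow>
       (down_up_algebra r s \<phi>\<^sub>1 \<cong>\<^sub>a\<^sub>l\<^sub>g down_up_algebra r s \<phi>\<^sub>2 \<longleftrightarrow> affine_equiv \<phi>\<^sub>1 \<phi>\<^sub>2)) \<and>
    (\<forall>(r\<^sub>1::'k) s\<^sub>1 r\<^sub>2 s\<^sub>2 \<phi>\<^sub>1 \<phi>\<^sub>2.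
       admissible r\<^sub>1 \<and> admissible s\<^sub>1 \<and> admissible r\<^sub>2 \<and> admissible s\<^sub>2 \<and>
       (\<forall>i\<^sub>1 j\<^sub>1 i\<^sub>2 j\<^sub>2 :: int.
          r\<^sub>1 powi i\<^sub>1 * s\<^sub>1 powi j\<^sub>1 = 1 \<and> r\<^sub>2 powi i\<^sub>2 * s\<^sub>2 powi j\<^sub>2 = 1 \<longrightarrow>
          i\<^sub>1 = 0 \<and> j\<^sub>1 = 0 \<and> i\<^sub>2 = 0 \<and> j\<^sub>2 = 0) \<longrightarrow>
       (down_up_algebra r\<^sub>1 s\<^sub>1 \<phi>\<^sub>1 \<cong>\<^sub>a\<^sub>l\<^sub>g down_up_algebra r\<^sub>2 s\<^sub>2 \<phi>\<^sub>2 \<longleftrightarrow>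
          (r\<^sub>1 = r\<^sub>2 \<and> s\<^sub>1 = s\<^sub>2 \<and> affine_equiv \<phi>\<^sub>1 \<phi>\<^sub>2) \<or>
          (r\<^sub>1 = s\<^sub>2 \<and> r\<^sub>2 = s\<^sub>1 \<and> affine_equiv \<phi>\<^sub>1 \<phi>\<^sub>2) \<or>
          (r\<^sub>1 = inverse s\<^sub>2 \<and> r\<^sub>2 = inverse s\<^sub>1 \<and> affine_equiv \<phi>\<^sub>1 \<phi>\<^sub>2) \<or>
          (r\<^sub>1 = inverse r\<^sub>2 \<and> s\<^sub>1 = inverse s\<^sub>2 \<and> affine_equiv \<phi>\<^sub>1 \<phi>\<^sub>2))) \<and>
    (\<forall>(r::'k) \<phi>\<^sub>1 \<phi>\<^sub>2.
       admissible r \<longrightarrow>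
       (down_up_algebra r (inverse r) \<phi>\<^sub>1 \<cong>\<^sub>a\<^sub>l\<^sub>g down_up_algebra r (inverse r) \<phi>\<^sub>2 \<longleftrightarrow>
          affine_equiv \<phi>\<^sub>1 \<phi>\<^sub>2))"
proof (intro conjI allI impI)
  show "\<not> down_up_algebra r\<^sub>1 s\<^sub>1 \<phi>\<^sub>1 \<cong>\<^sub>a\<^sub>l\<^sub>g down_up_algebra r\<^sub>2 s\<^sub>2 \<phi>\<^sub>2"
    if "admissible r\<^sub>1 \<and> admissible s\<^sub>1 \<and> admissible r\<^sub>2 \<and> admissible s\<^sub>2 \<and>
      mult_independent r\<^sub>1 s\<^sub>1 \<and> \<not> mult_independent r\<^sub>2 s\<^sub>2"
    for r\<^sub>1 s\<^sub>1 r\<^sub>2 s\<^sub>2 :: 'k and \<phi>\<^sub>1 \<phi>\<^sub>2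
    using that isomorphic_iff_distinct_parameters[of r\<^sub>1 s\<^sub>1 r\<^sub>2 s\<^sub>2 \<phi>\<^sub>1 \<phi>\<^sub>2]
      mult_independent_distinct mult_independent_of_parameters admissible_nontrivial by blast
next
  show "down_up_algebra r s \<phi>\<^sub>1 \<cong>\<^sub>a\<^sub>l\<^sub>g down_up_algebra r s \<phi>\<^sub>2 \<longleftrightarrow> affine_equiv \<phi>\<^sub>1 \<phi>\<^sub>2"
    if "admissible r \<and> admissible s \<and> mult_independent r s" for r s :: 'k and \<phi>\<^sub>1 \<phi>\<^sub>2
    using that admissible_nontrivial isomorphic_iff_affine_equiv by blast
next
  fix r\<^sub>1 s\<^sub>1 r\<^sub>2 s\<^sub>2 :: 'k and \<phi>\<^sub>1 \<phi>\<^sub>2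
  assume asm: "admissible r\<^sub>1 \<and> admissible s\<^sub>1 \<and> admissible r\<^sub>2 \<and> admissible s\<^sub>2 \<and>
    (\<forall>i\<^sub>1 j\<^sub>1 i\<^sub>2 j\<^sub>2 :: int. r\<^sub>1 powi i\<^sub>1 * s\<^sub>1 powi j\<^sub>1 = 1 \<and> r\<^sub>2 powi i\<^sub>2 * s\<^sub>2 powi j\<^sub>2 = 1 \<longrightarrow>
      i\<^sub>1 = 0 \<and> j\<^sub>1 = 0 \<and> i\<^sub>2 = 0 \<and> j\<^sub>2 = 0)"
  have "i = 0 \<and> j = 0" if "r\<^sub>1 powi i * s\<^sub>1 powi j = 1" for i j
  proof -
    have "r\<^sub>2 powi 0 * s\<^sub>2 powi 0 = 1" by simp
    with that asm show ?thesis by blast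
  qed
  then have "mult_independent r\<^sub>1 s\<^sub>1" by (simp add: mult_independent_def)
  then have "r\<^sub>1 \<noteq> s\<^sub>1" using asm mult_independent_distinct admissible_nontrivial by blast
  then have "down_up_algebra r\<^sub>1 s\<^sub>1 \<phi>\<^sub>1 \<cong>\<^sub>a\<^sub>l\<^sub>g down_up_algebra r\<^sub>2 s\<^sub>2 \<phi>\<^sub>2 \<longleftrightarrow>
      ({r\<^sub>1, s\<^sub>1} = {r\<^sub>2, s\<^sub>2} \<or> {inverse r\<^sub>1, inverse s\<^sub>1} = {r\<^sub>2, s\<^sub>2}) \<and> affine_equiv \<phi>\<^sub>1 \<phi>\<^sub>2"
    using asm isomorphic_iff_distinct_parameters by blast
  also have "\<dots> \<longleftrightarrow> (r\<^sub>1 = r\<^sub>2 \<and> s\<^sub>1 = s\<^sub>2 \<and> affine_equiv \<phi>\<^sub>1 \<phi>\<^sub>2) \<or>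
      (r\<^sub>1 = s\<^sub>2 \<and> r\<^sub>2 = s\<^sub>1 \<and> affine_equiv \<phi>\<^sub>1 \<phi>\<^sub>2) \<or>
      (r\<^sub>1 = inverse s\<^sub>2 \<and> r\<^sub>2 = inverse s\<^sub>1 \<and> affine_equiv \<phi>\<^sub>1 \<phi>\<^sub>2) \<or>
      (r\<^sub>1 = inverse r\<^sub>2 \<and> s\<^sub>1 = inverse s\<^sub>2 \<and> affine_equiv \<phi>\<^sub>1 \<phi>\<^sub>2)"
    by (auto simp: doubleton_eq_iff)
  finally show "down_up_algebra r\<^sub>1 s\<^sub>1 \<phi>\<^sub>1 \<cong>\<^sub>a\<^sub>l\<^sub>g down_up_algebra r\<^sub>2 s\<^sub>2 \<phi>\<^sub>2 \<longleftrightarrow>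
      (r\<^sub>1 = r\<^sub>2 \<and> s\<^sub>1 = s\<^sub>2 \<and> affine_equiv \<phi>\<^sub>1 \<phi>\<^sub>2) \<or>
      (r\<^sub>1 = s\<^sub>2 \<and> r\<^sub>2 = s\<^sub>1 \<and> affine_equiv \<phi>\<^sub>1 \<phi>\<^sub>2) \<or>
      (r\<^sub>1 = inverse s\<^sub>2 \<and> r\<^sub>2 = inverse s\<^sub>1 \<and> affine_equiv \<phi>\<^sub>1 \<phi>\<^sub>2) \<or>
      (r\<^sub>1 = inverse r\<^sub>2 \<and> s\<^sub>1 = inverse s\<^sub>2 \<and> affine_equiv \<phi>\<^sub>1 \<phi>\<^sub>2)" .
next
  fix r :: 'k and \<phi>\<^sub>1 \<phi>\<^sub>2
  assume "admissible r"
  then have "r \<noteq> 1" "inverse r \<noteq> 1" using admissible_nontrivial by (auto simp: inverse_eq_1_iff)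
  then show "down_up_algebra r (inverse r) \<phi>\<^sub>1 \<cong>\<^sub>a\<^sub>l\<^sub>g down_up_algebra r (inverse r) \<phi>\<^sub>2 \<longleftrightarrow>
      affine_equiv \<phi>\<^sub>1 \<phi>\<^sub>2"
    by (rule isomorphic_iff_affine_equiv)
qed

end
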